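(* Let $X$ be a compact metric space, $T:X\to X$ continuous, and $\phi\in C(X)$. Every ergodic equilibrium state for $\phi$ is an exposed point of $\partial P(\phi)$.
   Context: $C(X)$ carries the supremum norm, with dual the space $\mathcal{M}(X)$ of signed Radon measures. $\mathcal{M}_T(X)$ is the set of $T$-invariant Borel probability measures; $h_\mu(T)$ is the measure-theoretic entropy. Let $d_n(x,y)=\max_{0\le k<n}d(T^kx,T^ky)$; $E\subset X$ is $(n,\epsilon)$-separated if $d_n(x,y)>\epsilon$ for distinct $x,y\in E$. With $S_n\phi=\sum_{k=0}^{n-1}\phi\circ T^k$ and $Q_n(\phi,\epsilon)=\sup\{\sum_{x\in E}e^{S_n\phi(x)}: E\ (n,\epsilon)\text{-separated}\}$, the topological pressure is $P(\phi)=\lim_{\epsilon\to0}\limsup_{n\to\infty}\frac1n\log Q_n(\phi,\epsilon)$, treated as a real-valued functional on $C(X)$. An equilibrium state for $\phi$ is $\mu\in\mathcal{M}_T(X)$ with $h_\mu(T)+\int\phi\,d\mu=P(\phi)$. $\partial P(\phi)$ is the set of $\mu\in\mathcal{M}(X)$ with $P(\psi)\ge P(\phi)+\int(\psi-\phi)\,d\mu$ for all $\psi\in C(X)$. A point $\mu$ of a convex set $C\subset\mathcal{M}(X)$ is exposed if there is $\psi\in C(X)$ with $\int\psi\,d\mu>\int\psi\,d\nu$ for all $\nu\in C\setminus\{\mu\}$. *)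

theory Defs
  imports "HOL-Probability.Probability"
begin

text \<open>
  A compact metric space \<open>X\<close> is a type of class \<^class>\<open>metric_space\<close> whose universe is compact;
  \<open>C(X)\<close> consists of the functions \<open>f\<close> with \<open>continuous_on UNIV f\<close>.
\<close>


subsection \<open>Topological pressure\<close>

definition birkhoff_sum :: "('a \<Rightarrow> 'a) \<Rightarrow> ('a \<Rightarrow> real) \<Rightarrow> nat \<Rightarrow> 'a \<Rightarrow> real" where
  "birkhoff_sum T \<phi> n x = (\<Sum>k<n. \<phi> ((T ^^ k) x))"

text \<open>
  For \<open>n = 0\<close> the maximum is taken over the empty set and has no meaning; only the limit
  \<open>n \<rightarrow> \<infinity>\<close> is used below.
\<close>

definition bowen_dist :: "('a::metric_space \<Rightarrow> 'a) \<Rightarrow> nat \<Rightarrow> 'a \<Rightarrow> 'a \<Rightarrow> real" where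
  "bowen_dist T n x y = Max ((\<lambda>k. dist ((T ^^ k) x) ((T ^^ k) y)) ` {..<n})"

definition separated :: "('a::metric_space \<Rightarrow> 'a) \<Rightarrow> nat \<Rightarrow> real \<Rightarrow> 'a set \<Rightarrow> bool" where
  "separated T n \<epsilon> E \<longleftrightarrow> (\<forall>x\<in>E. \<forall>y\<in>E. x \<noteq> y \<longrightarrow> bowen_dist T n x y > \<epsilon>)"

text \<open>
  If \<open>X\<close> is compact, \<open>T\<close> continuous, \<open>n > 0\<close> and \<open>\<epsilon> > 0\<close>, then separated sets are
  automatically finite, with bounded cardinality, so the real supremum is over a bounded set.
  Finiteness is required explicitly because \<^const>\<open>sum\<close> is \<open>0\<close> on infinite sets.
\<close>

definition separated_sup ::
    "('a::metric_space \<Rightarrow> 'a) \<Rightarrow> ('a \<Rightarrow> real) \<Rightarrow> nat \<Rightarrow> real \<Rightarrow> real" where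
  "separated_sup T \<phi> n \<epsilon> =
     (SUP E\<in>{E. finite E \<and> separated T n \<epsilon> E}. \<Sum>x\<in>E. exp (birkhoff_sum T \<phi> n x))"

definition pressure :: "('a::metric_space \<Rightarrow> 'a) \<Rightarrow> ('a \<Rightarrow> real) \<Rightarrow> ereal" where
  "pressure T \<phi> =
     Lim (at_right 0) (\<lambda>\<epsilon>. limsup (\<lambda>n. ereal (ln (separated_sup T \<phi> n \<epsilon>) / real n)))"


subsection \<open>Invariant measures, entropy, equilibrium states\<close>

definition invariant_measures :: "('a::topological_space \<Rightarrow> 'a) \<Rightarrow> 'a measure set" where
  "invariant_measures T = {\<mu>. prob_space \<mu> \<and> sets \<mu> = sets borel \<and> distr \<mu> borel T = \<mu>}"

definition ergodic :: "('a::topological_space \<Rightarrow> 'a) \<Rightarrow> 'a measure \<Rightarrow> bool" where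
  "ergodic T \<mu> \<longleftrightarrow> \<mu> \<in> invariant_measures T \<and>
     (\<forall>A\<in>sets borel. T -` A = A \<longrightarrow> measure \<mu> A = 0 \<or> measure \<mu> A = 1)"

definition borel_partition :: "'a::topological_space set set \<Rightarrow> bool" where
  "borel_partition \<xi> \<longleftrightarrow> partition_on UNIV \<xi> \<and> finite \<xi> \<and> \<xi> \<subseteq> sets borel"

text \<open>The join of the partitions \<open>T\<^sup>-\<^sup>k \<xi>\<close> for \<open>k < n\<close>.\<close>

definition iterated_join :: "('a \<Rightarrow> 'a) \<Rightarrow> 'a set set \<Rightarrow> nat \<Rightarrow> 'a set set" where
  "iterated_join T \<xi> n = (\<lambda>f. \<Inter>k<n. (T ^^ k) -` f k) ` ({..<n} \<rightarrow>\<^sub>E \<xi>) - {{}}"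

text \<open>The convention \<open>0 log 0 = 0\<close> holds automatically.\<close>

definition partition_entropy :: "'a measure \<Rightarrow> 'a set set \<Rightarrow> real" where
  "partition_entropy \<mu> \<xi> = - (\<Sum>A\<in>\<xi>. measure \<mu> A * ln (measure \<mu> A))"

definition measure_entropy :: "('a::topological_space \<Rightarrow> 'a) \<Rightarrow> 'a measure \<Rightarrow> ereal" where
  "measure_entropy T \<mu> =
     (SUP \<xi>\<in>{\<xi>. borel_partition \<xi>}.
        ereal (lim (\<lambda>n. partition_entropy \<mu> (iterated_join T \<xi> n) / real n)))"

definition equilibrium_state ::
    "('a::metric_space \<Rightarrow> 'a) \<Rightarrow> ('a \<Rightarrow> real) \<Rightarrow> 'a measure \<Rightarrow> bool" where
  "equilibrium_state T \<phi> \<mu> \<longleftrightarrow> \<mu> \<in> invariant_measures T \<and>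
     measure_entropy T \<mu> + ereal (\<integral>x. \<phi> x \<partial>\<mu>) = pressure T \<phi>"


subsection \<open>Signed Radon measures\<close>

text \<open>
  A signed Radon measure is represented by its set function, extended by \<open>0\<close> to the non-Borel
  sets so that equality of set functions is equality of measures; a finite Borel measure \<open>M\<close> is
  thus represented by \<open>measure M\<close>. The last conjunct is inner regularity of the total variation:
  the supremum of \<open>\<bar>\<nu> B\<bar>\<close> over Borel sets \<open>B \<subseteq> S\<close> lies between one half of the total variation
  of \<open>S\<close> and the total variation of \<open>S\<close>.
\<close>

definition signed_radon_measures :: "('a::topological_space set \<Rightarrow> real) set" where
  "signed_radon_measures = {\<nu>.
     (\<forall>A. A \<notin> sets borel \<longrightarrow> \<nu> A = 0) \<and>
     (\<forall>A :: nat \<Rightarrow> 'a set. range A \<subseteq> sets borel \<longrightarrow> disjoint_family A \<longrightarrow>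
        (\<lambda>n. \<nu> (A n)) sums \<nu> (\<Union>n. A n)) \<and>
     (\<forall>A\<in>sets borel. \<forall>e>0. \<exists>K. compact K \<and> K \<in> sets borel \<and> K \<subseteq> A \<and>
        (\<forall>B\<in>sets borel. B \<subseteq> A - K \<longrightarrow> \<bar>\<nu> B\<bar> < e))}"

text \<open>
  The positive part of the Jordan decomposition; the negative part is the positive part of
  \<open>- \<nu>\<close>. Since \<^const>\<open>ennreal\<close> truncates negative reals to \<open>0\<close> and \<open>\<nu> {} = 0\<close>, the
  truncation does not affect the supremum.
\<close>

definition jordan_pos :: "('a::topological_space set \<Rightarrow> real) \<Rightarrow> 'a measure" where
  "jordan_pos \<nu> =
     measure_of UNIV (sets borel) (\<lambda>A. SUP B\<in>{B\<in>sets borel. B \<subseteq> A}. ennreal (\<nu> B))"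

definition signed_integral ::
    "('a::topological_space set \<Rightarrow> real) \<Rightarrow> ('a \<Rightarrow> real) \<Rightarrow> real" where
  "signed_integral \<nu> f =
     (\<integral>x. f x \<partial>jordan_pos \<nu>) - (\<integral>x. f x \<partial>jordan_pos (\<lambda>A. - \<nu> A))"

lemma jordan_pos_measure:
  fixes M :: "'a::topological_space measure"
  assumes "finite_measure M" "sets M = sets borel"
  shows "jordan_pos (measure M) = M"
proof -
  interpret finite_measure M by fact
  have sp: "space M = UNIV" using assms(2) sets_eq_imp_space_eq by fastforce
  have "(SUP B\<in>{B\<in>sets borel. B \<subseteq> A}. ennreal (measure M B)) = emeasure M A"
    if "A \<in> sets borel" for A
    using that assms(2)
    by (intro antisym SUP_least SUP_upper2[of A])
       (auto simp: emeasure_eq_measure[symmetric] intro: emeasure_mono)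
  then have "jordan_pos (measure M) = measure_of UNIV (sets borel) (emeasure M)"
    unfolding jordan_pos_def
    using sets.sigma_sets_eq[of "borel :: 'a measure"] by (intro measure_of_eq) auto
  also have "\<dots> = M" using measure_of_of_measure[of M] sp assms(2) by simp
  finally show ?thesis .
qed

lemma jordan_pos_uminus_measure:
  "jordan_pos (\<lambda>A. - measure M A) = null_measure (borel :: 'a::topological_space measure)"
proof -
  have "(SUP B\<in>{B\<in>sets borel. B \<subseteq> A}. ennreal (- measure M B)) = 0" for A :: "'a set"
    by (auto simp: ennreal_neg intro!: SUP_eq_const)
  then show ?thesis by (simp add: jordan_pos_def null_measure_def)
qed

lemma signed_integral_measure:
  assumes "finite_measure M" "sets M = sets borel"
  shows "signed_integral (measure M) f = (\<integral>x. f x \<partial>M)"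
  by (simp add: signed_integral_def jordan_pos_measure[OF assms] jordan_pos_uminus_measure)


subsection \<open>Subdifferential of the pressure, exposed points\<close>

definition pressure_subdifferential ::
    "('a::metric_space \<Rightarrow> 'a) \<Rightarrow> ('a \<Rightarrow> real) \<Rightarrow> ('a set \<Rightarrow> real) set" where
  "pressure_subdifferential T \<phi> = {\<nu>\<in>signed_radon_measures.
     \<forall>\<psi>. continuous_on UNIV \<psi> \<longrightarrow>
       pressure T \<psi> \<ge> pressure T \<phi> + ereal (signed_integral \<nu> (\<lambda>x. \<psi> x - \<phi> x))}"

definition exposed_point ::
    "('a::topological_space set \<Rightarrow> real) set \<Rightarrow> ('a set \<Rightarrow> real) \<Rightarrow> bool" where
  "exposed_point C \<mu> \<longleftrightarrow> \<mu> \<in> C \<and>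
     (\<exists>\<psi>. continuous_on UNIV \<psi> \<and>
        (\<forall>\<nu>\<in>C - {\<mu>}. signed_integral \<mu> \<psi> > signed_integral \<nu> \<psi>))"

end

theory Submission
  imports Defs
begin

text \<open>
  Monotonicity of the pressure, its behaviour under constants and its invariance under coboundaries
  force every subgradient to be an invariant probability measure, and \<open>h\<^sub>\<mu>(T) + \<integral>\<psi> d\<mu> \<le> P(\<psi>)\<close> shows
  that the equilibrium state \<open>\<mu>\<close> is a subgradient. So it suffices to expose an ergodic \<open>\<mu>\<close> in the
  set of all invariant measures (Jenkinson). For \<open>g\<close> with \<open>\<integral>g d\<mu> = 0\<close> the functions
  \<open>min (- S\<^sub>n g / n) 0\<close> have integral at most \<open>min (- \<integral>g d\<nu>) 0\<close> for every invariant \<open>\<nu>\<close>, and by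
  ergodicity their \<open>\<mu>\<close>-integrals tend to \<open>0\<close>. A sequence of corrections of summable size turns
  this into one continuous \<open>f\<close> with \<open>\<integral>f d\<nu> \<le> min (- \<integral>g d\<nu>) 0\<close> and \<open>\<integral>f d\<mu> = 0\<close>; summing such
  \<open>f\<close> over a countable determining family of \<open>g\<close> gives the exposing function.

  For the entropy inequality, let \<open>\<pi>\<close> send each point to a nearby point of a maximal
  \<open>(n, \<delta>)\<close>-separated set. Given \<open>\<pi> x\<close>, the itinerary of \<open>x\<close> through a partition \<open>\<xi>\<close> is ambiguous
  only at the times when the orbit leaves compact cores of the members of \<open>\<xi>\<close>. Recording the
  itinerary at those times costs entropy at most \<open>n\<close> times that of a partition with one member of
  nearly full measure, which is small. Hence no passage to powers of \<open>T\<close> is needed.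
\<close>

subsection \<open>Finite Borel measures on metric spaces\<close>

text \<open>Lipschitz functions that decrease in \<open>k\<close> to the indicator of
  \<open>F\<close> when \<open>F\<close> is closed and nonempty. As \<open>infdist x {} = 0\<close>,
  the case \<open>F = {}\<close> gives the constant 1, whence the nonemptiness conditions
  below.\<close>

definition bump :: "'a::metric_space set \<Rightarrow> nat \<Rightarrow> 'a \<Rightarrow> real" where
  "bump F k x = max 0 (1 - real k * infdist x F)"

lemma bump_nonneg: "0 \<le> bump F k x" and bump_le_1: "bump F k x \<le> 1"
  by (auto simp: bump_def infdist_nonneg)

lemma continuous_bump: "continuous_on UNIV (bump F k)"
  unfolding bump_def[abs_def] by (intro continuous_intros)

lemma bump_tendsto:
  assumes "closed F" "F \<noteq> {}"
  shows "(\<lambda>k. bump F k x) \<longlonglongrightarrow> indicator F x"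
proof (cases "x \<in> F")
  case True
  then show ?thesis by (simp add: bump_def)
next
  case False
  then have pos: "infdist x F > 0" using infdist_pos_not_in_closed assms by blast
  obtain N :: nat where N: "1 / infdist x F < real N" using reals_Archimedean2 by blast
  have "bump F k x = 0" if "k \<ge> N" for k
  proof -
    have "1 / infdist x F < real k" using N that by linarith
    then have "1 < real k * infdist x F" using pos by (simp add: field_simps)
    then show ?thesis by (simp add: bump_def)
  qed
  then show ?thesis using False
    by (auto intro!: tendsto_eventually eventually_sequentiallyI[of N])
qed

lemma integrable_continuous_compact:
  fixes f :: "'a::metric_space \<Rightarrow> real"
  assumes "compact (UNIV :: 'a set)" "finite_measure M" "sets M = sets borel" "continuous_on UNIV f"
  shows "integrable M f"
proof -
  interpret finite_measure M by fact
  have "compact (range f)" using assms compact_continuous_image by blast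
  then obtain B where B: "\<And>x. \<bar>f x\<bar> \<le> B"
    by (metis bounded_iff compact_imp_bounded rangeI real_norm_def)
  have "f \<in> borel_measurable M"
    using borel_measurable_continuous_onI[OF assms(4)] by (simp cong: measurable_cong_sets add: assms(3))
  then show ?thesis using B by (intro integrable_const_bound[of _ B]) auto
qed

lemma integral_bump_tendsto:
  assumes "finite_measure M" "sets M = sets borel" "closed F" "F \<noteq> {}"
  shows "(\<lambda>k. \<integral>x. bump F k x \<partial>M) \<longlonglongrightarrow> measure M F"
proof -
  interpret finite_measure M by fact
  have "(\<lambda>k. \<integral>x. bump F k x \<partial>M) \<longlonglongrightarrow> (\<integral>x. indicator F x \<partial>M)"
  proof (rule integral_dominated_convergence[where w="\<lambda>_. 1"])
    have "bump F k \<in> borel_measurable borel" for k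
      by (rule borel_measurable_continuous_onI[OF continuous_bump])
    then show "bump F k \<in> borel_measurable M" for k
      by (simp cong: measurable_cong_sets add: assms(2))
    have "F \<in> sets M" using assms by simp
    then show "indicator F \<in> borel_measurable M" by measurable
  qed (use bump_tendsto[OF assms(3,4)] in \<open>auto simp: bump_le_1 bump_nonneg abs_of_nonneg\<close>)
  moreover have "F \<in> sets M" using assms by simp
  ultimately show ?thesis using sets.sets_into_space[of F M] by (simp add: Int_absorb1 Int_commute)
qed

text \<open>Regularity of finite Borel measures: the sets with such approximations form a
  sigma-algebra, and a nonempty closed set is the intersection of its open
  \<open>1 / (n + 1)\<close>-neighbourhoods.\<close>

lemma closed_open_approx:
  fixes M :: "'a::metric_space measure"
  assumes "finite_measure M" "sets M = sets borel" "A \<in> sets borel" "e > 0"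
  shows "\<exists>F U. closed F \<and> open U \<and> F \<subseteq> A \<and> A \<subseteq> U \<and> measure M (U - F) < e"
proof -
  interpret finite_measure M by fact
  have "A \<in> sigma_sets UNIV (Collect closed)"
    using assms(3) by (metis borel_eq_closed sets_measure_of subset_UNIV Pow_UNIV)
  then show ?thesis using \<open>e > 0\<close>
  proof (induction arbitrary: e rule: sigma_sets.induct)
    case (Basic F)
    show ?case
    proof (cases "F = {}")
      case True
      then show ?thesis using Basic by (intro exI[of _ "{}"]) auto
    next
      case False
      define U where "U n = {x. infdist x F < 1 / real (Suc n)}" for n
      have op: "open (U n)" for n
        unfolding U_def by (intro open_Collect_less continuous_intros)
      have FU: "F \<subseteq> U n" for n by (auto simp: U_def)
      have "(\<Inter>n. U n - F) = {}"
      proof -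
        { fix x assume x: "\<And>n. x \<in> U n" "x \<notin> F"
          then have "infdist x F > 0" using infdist_pos_not_in_closed Basic False by blast
          then obtain n where "1 / real (Suc n) < infdist x F"
            using nat_approx_posE by blast
          then have False using x(1)[of n] by (auto simp: U_def) }
        then show ?thesis by blast
      qed
      moreover have "decseq (\<lambda>n. U n - F)"
        unfolding decseq_Suc_iff U_def
        by (auto elim!: order.strict_trans2 intro!: frac_le)
      moreover have "range (\<lambda>n. U n - F) \<subseteq> sets M" using op Basic assms(2) by auto
      ultimately have "(\<lambda>n. measure M (U n - F)) \<longlonglongrightarrow> 0"
        using finite_Lim_measure_decseq[of "\<lambda>n. U n - F"] by (simp del: INT_simps)
      then have "eventually (\<lambda>n. measure M (U n - F) < e) sequentially"
        using Basic(2) by (rule order_tendstoD)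
      then obtain n where "measure M (U n - F) < e" by (auto simp: eventually_sequentially)
      then show ?thesis using op FU Basic by blast
    qed
  next
    case Empty
    then show ?case by (intro exI[of _ "{}"]) auto
  next
    case (Compl A)
    obtain F U where FU: "closed F" "open U" "F \<subseteq> A" "A \<subseteq> U" "measure M (U - F) < e"
      using Compl.IH[OF Compl.prems] by blast
    moreover have "- F - (- U) = U - F" by auto
    ultimately show ?case
      by (intro exI[of _ "-U"] exI[of _ "-F"]) (auto simp: open_Compl closed_Compl)
  next
    case (Union A)
    have "\<exists>F U. closed F \<and> open U \<and> F \<subseteq> A i \<and> A i \<subseteq> U \<and> measure M (U - F) < e / 2 * (1/2)^Suc i" for i
      using Union by (intro Union.IH) auto
    then obtain F U where FU: "\<And>i. closed (F i)" "\<And>i. open (U i)" "\<And>i. F i \<subseteq> A i" "\<And>i. A i \<subseteq> U i"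
      "\<And>i. measure M (U i - F i) < e / 2 * (1/2)^Suc i" by metis
    have [measurable]: "F i \<in> sets M" "U i \<in> sets M" for i using FU assms(2) by auto
    have s: "(\<lambda>i. e / 2 * (1/2)^Suc i) sums (e/2)"
      using sums_mult[OF power_half_series, of "e/2"] by simp
    have sm: "summable (\<lambda>i. measure M (U i - F i))"
      using FU(5) by (intro summable_comparison_test'[OF sums_summable[OF s], of 0]) (auto intro: less_imp_le)
    have "measure M ((\<Union>i. U i) - (\<Union>i. F i)) \<le> measure M (\<Union>i. U i - F i)"
      by (intro finite_measure_mono) auto
    also have "\<dots> \<le> (\<Sum>i. measure M (U i - F i))"
      using sm by (intro finite_measure_subadditive_countably) auto
    also have "\<dots> \<le> (\<Sum>i. e / 2 * (1/2)^Suc i)"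
      using FU(5) by (intro suminf_le sm sums_summable[OF s]) (auto intro: less_imp_le)
    also have "\<dots> < e" using sums_unique[OF s] Union(3) by simp
    finally have lt: "measure M ((\<Union>i. U i) - (\<Union>i. F i)) < e" .
    \<comment> \<open>A countable union of closed sets need not be closed. Continuity from above
      shows that finitely many \<open>F i\<close> already suffice.\<close>
    have "(\<lambda>n. measure M ((\<Union>i. U i) - (\<Union>i<n. F i))) \<longlonglongrightarrow> measure M (\<Inter>n. (\<Union>i. U i) - (\<Union>i<n. F i))"
      by (intro finite_Lim_measure_decseq) (auto simp: decseq_def)
    also have "(\<Inter>n. (\<Union>i. U i) - (\<Union>i<n. F i)) = (\<Union>i. U i) - (\<Union>i. F i)"
      by auto
    finally have "eventually (\<lambda>n. measure M ((\<Union>i. U i) - (\<Union>i<n. F i)) < e) sequentially"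
      using lt by (rule order_tendstoD)
    then obtain n where "measure M ((\<Union>i. U i) - (\<Union>i<n. F i)) < e" by (auto simp: eventually_sequentially)
    then show ?case
      using FU by (intro exI[of _ "\<Union>i<n. F i"] exI[of _ "\<Union>i. U i"]) (auto; blast)
  qed
qed

text \<open>Closed inner approximation extends the inequality to all Borel sets; passing to
  complements reverses it because both total masses are 1.\<close>

lemma prob_eq_if_le_on_closed:
  fixes M N :: "'a::metric_space measure"
  assumes M: "prob_space M" "sets M = sets borel" and N: "prob_space N" "sets N = sets borel"
    and le: "\<And>F. closed F \<Longrightarrow> F \<noteq> {} \<Longrightarrow> measure M F \<le> measure N F"
  shows "M = N"
proof -
  interpret M: prob_space M by fact
  interpret N: prob_space N by fact
  have sp: "space M = UNIV" "space N = UNIV"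
    using sets_eq_imp_space_eq[OF M(2)] sets_eq_imp_space_eq[OF N(2)] by simp_all
  have le': "measure M A \<le> measure N A" if A: "A \<in> sets borel" for A
  proof (rule field_le_epsilon)
    fix e :: real assume "e > 0"
    then obtain F U where FU: "closed F" "open U" "F \<subseteq> A" "A \<subseteq> U" "measure M (U - F) < e"
      using closed_open_approx[OF M.finite_measure_axioms M(2) A, of e] by blast
    have "measure M A \<le> measure M (F \<union> (U - F))"
      using FU M by (intro M.finite_measure_mono) auto
    also have "\<dots> \<le> measure M F + measure M (U - F)"
      using FU M by (intro measure_Un_le) auto
    also have "measure M F \<le> measure N F" using le FU by (cases "F = {}") auto
    also have "measure N F \<le> measure N A" using FU A N by (intro N.finite_measure_mono) auto
    finally show "measure M A \<le> measure N A + e" using FU by linarith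
  qed
  show ?thesis
  proof (rule measure_eqI)
    fix A assume "A \<in> sets M"
    then have A: "A \<in> sets borel" using M by simp
    have "measure M (UNIV - A) = 1 - measure M A" "measure N (UNIV - A) = 1 - measure N A"
      using M.prob_compl[of A] N.prob_compl[of A] A M N sp by auto
    then have "measure M A = measure N A" using le'[OF A] le'[of "UNIV - A"] A by auto
    then show "emeasure M A = emeasure N A"
      by (simp add: M.emeasure_eq_measure N.emeasure_eq_measure)
  qed (simp add: M N)
qed

lemma prob_eq_if_integral_le:
  fixes M N :: "'a::metric_space measure"
  assumes M: "prob_space M" "sets M = sets borel" and N: "prob_space N" "sets N = sets borel"
    and le: "\<And>F k. closed F \<Longrightarrow> F \<noteq> {} \<Longrightarrow> (\<integral>x. bump F k x \<partial>M) \<le> (\<integral>x. bump F k x \<partial>N)"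
  shows "M = N"
proof (rule prob_eq_if_le_on_closed[OF M N])
  fix F :: "'a set" assume F: "closed F" "F \<noteq> {}"
  show "measure M F \<le> measure N F"
    using F M N le prob_space.finite_measure
    by (intro LIMSEQ_le[OF integral_bump_tendsto integral_bump_tendsto]) blast+
qed

section \<open>Countably many test functions determine a probability measure\<close>

lemma compact_countable_net:
  assumes "compact (UNIV :: 'a::metric_space set)"
  obtains D :: "'a::metric_space set" where "countable D" "\<And>e. e > 0 \<Longrightarrow> \<exists>S. finite S \<and> S \<subseteq> D \<and> (\<forall>x. \<exists>s\<in>S. dist x s < e)"
proof -
  have ex: "\<exists>S. finite S \<and> (\<forall>x::'a. \<exists>s\<in>S. dist x s < 1 / real (Suc n))" for n
  proof -
    obtain S :: "'a set" where S: "finite S" "UNIV \<subseteq> (\<Union>x\<in>S. ball x (1 / real (Suc n)))"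
      using seq_compact_imp_totally_bounded[OF compact_imp_seq_compact[OF assms], rule_format, of "1 / real (Suc n)"]
      by auto
    have "\<exists>s\<in>S. dist x s < 1 / real (Suc n)" for x
    proof -
      have "x \<in> (\<Union>x\<in>S. ball x (1 / real (Suc n)))" using S by blast
      then show ?thesis by (auto simp: dist_commute)
    qed
    then show ?thesis using S by blast
  qed
  then have "\<forall>n. \<exists>S. finite S \<and> (\<forall>x::'a. \<exists>s\<in>S. dist x s < 1 / real (Suc n))" ..
  from choice[OF this] obtain S :: "nat \<Rightarrow> 'a set"
    where S: "\<And>n. finite (S n)" "\<And>n x. \<exists>s\<in>S n. dist x s < 1 / real (Suc n)"
    by auto
  show ?thesis
  proof
    show "countable (\<Union>n. S n :: 'a set)" using S by (intro countable_UN) (auto intro: countable_finite)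
    fix e :: real assume "e > 0"
    then obtain n where "1 / real (Suc n) < e" using nat_approx_posE by blast
    then show "\<exists>T. finite T \<and> T \<subseteq> (\<Union>n. S n) \<and> (\<forall>x. \<exists>s\<in>T. dist x s < e)"
      using S(1)[of n] S(2)[of n] by (intro exI[of _ "S n"]) (blast intro: order.strict_trans)
  qed
qed

text \<open>\<open>F\<close> is replaced by the net points near it. This finite set changes the
  distance function by at most \<open>2 * e\<close> uniformly in \<open>x\<close>, which reduces all
  closed sets to countably many finite ones.\<close>

lemma infdist_net_approx:
  assumes F: "F \<noteq> {}" and S: "finite S" "\<forall>x. \<exists>s\<in>S. dist x s < e" and e: "e > 0"
  defines "S' \<equiv> {s\<in>S. infdist s F < e}"
  shows "\<bar>infdist x S' - infdist x F\<bar> \<le> 2 * e"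
proof -
  have ne: "S' \<noteq> {}"
  proof -
    obtain y where "y \<in> F" using F by blast
    moreover obtain s where "s \<in> S" "dist y s < e" using S by blast
    ultimately have "infdist s F < e" by (metis dist_commute infdist_le order_le_less_trans)
    with \<open>s \<in> S\<close> show ?thesis by (auto simp: S'_def)
  qed
  have "infdist x F - 2 * e \<le> infdist x S'"
    unfolding infdist_notempty[OF ne]
  proof (rule cINF_greatest[OF ne])
    fix s assume "s \<in> S'"
    then show "infdist x F - 2 * e \<le> dist x s"
      using infdist_triangle[of x F s] e by (auto simp: S'_def)
  qed
  moreover have "infdist x S' - 2 * e \<le> infdist x F"
    unfolding infdist_notempty[OF F]
  proof (rule cINF_greatest[OF F])
    fix y assume y: "y \<in> F"
    obtain s where s: "s \<in> S" "dist y s < e" using S by blast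
    then have "infdist s F < e" using y by (metis dist_commute infdist_le order_le_less_trans)
    then have "infdist x S' \<le> dist x s" using s by (intro infdist_le) (auto simp: S'_def)
    also have "\<dots> \<le> dist x y + dist y s" by (rule dist_triangle)
    finally show "infdist x S' - 2 * e \<le> dist x y" using s e by linarith
  qed
  ultimately show ?thesis by linarith
qed

lemma bump_net_approx:
  assumes "\<bar>infdist x S - infdist x F\<bar> \<le> 2 * e"
  shows "\<bar>bump S k x - bump F k x\<bar> \<le> real k * (2 * e)"
proof -
  have "\<bar>real k * infdist x S - real k * infdist x F\<bar> \<le> real k * (2 * e)"
    using assms by (simp add: abs_mult right_diff_distrib[symmetric] mult_left_mono)
  then show ?thesis unfolding bump_def by linarith
qed

text \<open>The family consists of the bumps of finite subsets of a countable dense set. For fixed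
  \<open>k\<close> these approximate every \<open>bump F k\<close> uniformly. The one-sided form
  ensures that \<open>\<nu> \<noteq> \<mu>\<close> makes some \<open>g i\<close> have a strictly
  larger integral against \<nu> than against \<mu>.\<close>

lemma countable_determining_family:
  assumes "compact (UNIV :: 'a::metric_space set)"
  obtains g :: "nat \<Rightarrow> 'a::metric_space \<Rightarrow> real"
  where "\<And>i. continuous_on UNIV (g i)"
    "\<And>M N :: 'a::metric_space measure. prob_space M \<Longrightarrow> sets M = sets borel \<Longrightarrow> prob_space N \<Longrightarrow> sets N = sets borel \<Longrightarrow>
       (\<And>i. (\<integral>x. g i x \<partial>M) \<le> (\<integral>x. g i x \<partial>N)) \<Longrightarrow> M = N"
proof -
  obtain D :: "'a set" where D: "countable D"
    "\<And>e. e > 0 \<Longrightarrow> \<exists>S. finite S \<and> S \<subseteq> D \<and> (\<forall>x. \<exists>s\<in>S. dist x s < e)"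
    by (rule compact_countable_net[OF assms], rule that)
  define G where "G = {S. finite S \<and> S \<subseteq> D} \<times> (UNIV :: nat set)"
  have G: "countable G" "G \<noteq> {}"
    using D(1) by (auto simp: G_def intro!: countable_SIGMA countable_Collect_finite_subset)
  define g where "g i = (case from_nat_into G i of (S, k) \<Rightarrow> bump S k)" for i
  show ?thesis
  proof
    show "continuous_on UNIV (g i)" for i
      by (auto simp: g_def continuous_bump split: prod.split)
    fix M N :: "'a measure"
    assume M: "prob_space M" "sets M = sets borel" and N: "prob_space N" "sets N = sets borel"
      and le: "\<And>i. (\<integral>x. g i x \<partial>M) \<le> (\<integral>x. g i x \<partial>N)"
    have le': "(\<integral>x. bump S k x \<partial>M) \<le> (\<integral>x. bump S k x \<partial>N)" if "finite S" "S \<subseteq> D" for S k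
    proof -
      have "(S, k) \<in> G" using that by (auto simp: G_def)
      then have "g (to_nat_on G (S, k)) = bump S k" using G by (simp add: g_def)
      then show ?thesis using le[of "to_nat_on G (S, k)"] by simp
    qed
    have int: "integrable K (bump S k)" if "prob_space K" "sets K = sets borel" for K :: "'a measure" and S k
      using that assms continuous_bump prob_space.finite_measure
      by (intro integrable_continuous_compact) auto
    have close: "\<bar>(\<integral>x. f x \<partial>K) - (\<integral>x. h x \<partial>K)\<bar> \<le> c"
      if K: "prob_space K" and f: "integrable K f" "integrable K h" and fh: "\<And>x. \<bar>f x - h x\<bar> \<le> c"
      for K :: "'a measure" and f h :: "'a \<Rightarrow> real" and c
    proof -
      interpret K: prob_space K by fact
      have "\<bar>\<integral>x. f x - h x \<partial>K\<bar> \<le> (\<integral>x. \<bar>f x - h x\<bar> \<partial>K)" by (rule integral_abs_bound)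
      also have "\<dots> \<le> (\<integral>x. c \<partial>K)" using f fh by (intro integral_mono) auto
      finally show ?thesis using f by (simp add: K.prob_space)
    qed
    show "M = N"
    proof (rule prob_eq_if_integral_le[OF M N])
      fix F :: "'a set" and k assume F: "closed F" "F \<noteq> {}"
      show "(\<integral>x. bump F k x \<partial>M) \<le> (\<integral>x. bump F k x \<partial>N)"
      proof (rule field_le_epsilon)
        fix e :: real assume e: "e > 0"
        \<comment> \<open>Chosen so that \<open>real k * (2 * d) \<le> e / 2\<close>; the summand 1
          covers \<open>k = 0\<close>.\<close>
        define d where "d = e / (4 * (real k + 1))"
        have d: "d > 0" using e by (simp add: d_def)
        have kd: "real k * (2 * d) \<le> e / 2" using e by (simp add: d_def field_simps)
        obtain S where S: "finite S" "S \<subseteq> D" "\<forall>x. \<exists>s\<in>S. dist x s < d" using D(2)[OF d] by blast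
        define S' where "S' = {s\<in>S. infdist s F < d}"
        have ap: "\<bar>bump S' k x - bump F k x\<bar> \<le> e / 2" for x
          using bump_net_approx[OF infdist_net_approx[OF F(2) S(1,3) d], of k x] kd
          by (simp add: S'_def)
        have "\<bar>(\<integral>x. bump S' k x \<partial>M) - (\<integral>x. bump F k x \<partial>M)\<bar> \<le> e / 2"
          by (rule close[OF M(1) int[OF M] int[OF M] ap])
        moreover have "\<bar>(\<integral>x. bump S' k x \<partial>N) - (\<integral>x. bump F k x \<partial>N)\<bar> \<le> e / 2"
          by (rule close[OF N(1) int[OF N] int[OF N] ap])
        moreover have "(\<integral>x. bump S' k x \<partial>M) \<le> (\<integral>x. bump S' k x \<partial>N)"
          using S by (intro le') (auto simp: S'_def)
        ultimately show "(\<integral>x. bump F k x \<partial>M) \<le> (\<integral>x. bump F k x \<partial>N) + e" by linarith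
      qed
    qed
  qed
qed

subsection \<open>Topological pressure\<close>

lemma birkhoff_sum_Suc: "birkhoff_sum T f (Suc n) x = f x + birkhoff_sum T f n (T x)"
  unfolding birkhoff_sum_def by (subst sum.lessThan_Suc_shift) (simp add: funpow_swap1)

lemma birkhoff_sum_add:
  "birkhoff_sum T f (m + n) x = birkhoff_sum T f m x + birkhoff_sum T f n ((T ^^ m) x)"
  by (induction m arbitrary: x)
     (simp_all add: birkhoff_sum_Suc funpow_swap1, simp add: birkhoff_sum_def)

lemma birkhoff_sum_bound:
  fixes g :: "'a \<Rightarrow> real"
  assumes "\<And>x. \<bar>g x\<bar> \<le> B"
  shows "\<bar>birkhoff_sum T g n x\<bar> \<le> real n * B"
  unfolding birkhoff_sum_def using assms sum_bounded_above[of "{..<n}" "\<lambda>k. \<bar>g ((T ^^ k) x)\<bar>" B]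
  by (intro order_trans[OF sum_abs]) simp

lemma separated_iff:
  assumes "n > 0"
  shows "separated T n \<epsilon> E \<longleftrightarrow> (\<forall>x\<in>E. \<forall>y\<in>E. x \<noteq> y \<longrightarrow> (\<exists>k<n. dist ((T ^^ k) x) ((T ^^ k) y) > \<epsilon>))"
  unfolding separated_def bowen_dist_def using assms by (subst Max_gr_iff) auto

lemma separated_antimono:
  assumes "n > 0" "\<epsilon> \<le> \<epsilon>'" "separated T n \<epsilon>' E"
  shows "separated T n \<epsilon> E"
  using assms unfolding separated_iff[OF \<open>n > 0\<close>] by (meson le_less_trans)

text \<open>The pressure at a fixed scale, named because it is monotone in \<epsilon>, which settles
  the outer limit in \<open>pressure\<close>.\<close>

definition pressure_at :: "('a::metric_space \<Rightarrow> 'a) \<Rightarrow> ('a \<Rightarrow> real) \<Rightarrow> real \<Rightarrow> ereal" where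
  "pressure_at T \<phi> \<epsilon> = limsup (\<lambda>n. ereal (ln (separated_sup T \<phi> n \<epsilon>) / real n))"

locale compact_system =
  fixes T :: "'a::metric_space \<Rightarrow> 'a"
  assumes compact_space: "compact (UNIV :: 'a set)"
    and continuous_T: "continuous_on UNIV T"
begin

lemma continuous_iterate: "continuous_on UNIV (T ^^ k)"
proof (induction k)
  case (Suc k)
  then show ?case
    using continuous_on_compose[OF Suc continuous_on_subset[OF continuous_T]] by simp
qed (simp add: id_def)

lemma continuous_compose_iterate:
  "continuous_on UNIV f \<Longrightarrow> continuous_on UNIV (\<lambda>x. f ((T ^^ k) x))"
  by (rule continuous_on_compose2[OF _ continuous_iterate]) auto

lemma continuous_birkhoff_sum:
  fixes f :: "'a \<Rightarrow> real"
  shows "continuous_on UNIV f \<Longrightarrow> continuous_on UNIV (birkhoff_sum T f n)"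
  unfolding birkhoff_sum_def[abs_def] by (intro continuous_intros continuous_compose_iterate)

lemma bounded_continuous:
  fixes f :: "'a \<Rightarrow> real"
  assumes "continuous_on UNIV f"
  obtains B where "B \<ge> 0" "\<And>x. \<bar>f x\<bar> \<le> B"
proof -
  have "bounded (range f)"
    using assms compact_space compact_continuous_image compact_imp_bounded by blast
  then obtain B where B: "\<And>x. \<bar>f x\<bar> \<le> B" by (auto simp: bounded_iff)
  then have "B \<ge> 0" using abs_ge_zero order_trans by blast
  with B that show ?thesis by blast
qed

text \<open>Finitely many Bowen balls of radius \<open>\<epsilon> / 2\<close> cover the space, and
  each contains at most one point of a separated set. The bound makes the real supremum in
  \<open>separated_sup\<close> meaningful and later provides a separated set of maximal
  size.\<close>

lemma separated_card_le:
  assumes "n > 0" "\<epsilon> > 0"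
  obtains N where "\<And>E. finite E \<Longrightarrow> separated T n \<epsilon> E \<Longrightarrow> card E \<le> N"
proof -
  define U where "U x = {y. \<forall>k\<in>{..<n}. dist ((T ^^ k) y) ((T ^^ k) x) < \<epsilon> / 2}" for x
  have op: "open (U x)" for x
  proof -
    have "U x = (\<Inter>k<n. {y. dist ((T ^^ k) y) ((T ^^ k) x) < \<epsilon> / 2})" by (auto simp: U_def)
    moreover have "open {y. dist ((T ^^ k) y) ((T ^^ k) x) < \<epsilon> / 2}" for k
      by (intro open_Collect_less continuous_intros continuous_compose_iterate continuous_iterate)
    ultimately show ?thesis by auto
  qed
  have cover: "UNIV \<subseteq> (\<Union>x\<in>UNIV. U x)" using assms by (auto simp: U_def)
  obtain C where C: "C \<subseteq> UNIV" "finite C" "UNIV \<subseteq> (\<Union>x\<in>C. U x)"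
    by (rule compactE_image[OF compact_space op cover])
  have "\<exists>c. c \<in> C \<and> x \<in> U c" for x using C(3) by blast
  then obtain c where c: "\<And>x. c x \<in> C" "\<And>x. x \<in> U (c x)" by metis
  have "card E \<le> card C" if E: "finite E" "separated T n \<epsilon> E" for E
  proof (rule card_inj_on_le[of c])
    show "inj_on c E"
    proof (rule inj_onI, rule ccontr)
      fix x y assume xy: "x \<in> E" "y \<in> E" "c x = c y" "x \<noteq> y"
      then obtain k where k: "k < n" "dist ((T ^^ k) x) ((T ^^ k) y) > \<epsilon>"
        using E(2) separated_iff[OF assms(1)] by blast
      have "dist ((T ^^ k) x) ((T ^^ k) (c x)) < \<epsilon> / 2" "dist ((T ^^ k) y) ((T ^^ k) (c x)) < \<epsilon> / 2"
        using c(2)[of x] c(2)[of y] k xy by (auto simp: U_def)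
      then have "dist ((T ^^ k) x) ((T ^^ k) y) < \<epsilon>" by (rule dist_triangle_half_l)
      with k show False by simp
    qed
  qed (use c C in auto)
  then show ?thesis using that by blast
qed

lemma separated_sup_upper:
  assumes "n > 0" "\<epsilon> > 0" "continuous_on UNIV \<phi>" "finite E" "separated T n \<epsilon> E"
  shows "(\<Sum>x\<in>E. exp (birkhoff_sum T \<phi> n x)) \<le> separated_sup T \<phi> n \<epsilon>"
proof -
  obtain N where N: "\<And>E. finite E \<Longrightarrow> separated T n \<epsilon> E \<Longrightarrow> card E \<le> N"
    by (rule separated_card_le[OF assms(1,2)], rule that)
  obtain B where B: "\<And>x. \<bar>birkhoff_sum T \<phi> n x\<bar> \<le> B"
    by (rule bounded_continuous[OF continuous_birkhoff_sum[OF assms(3)]], rule that)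
  have "(\<Sum>x\<in>E. exp (birkhoff_sum T \<phi> n x)) \<le> real N * exp B" if "finite E" "separated T n \<epsilon> E" for E
  proof -
    have "(\<Sum>x\<in>E. exp (birkhoff_sum T \<phi> n x)) \<le> (\<Sum>x\<in>E. exp B)"
      using B by (intro sum_mono) (simp add: abs_le_iff)
    also have "\<dots> \<le> real N * exp B" using N[OF that] by simp
    finally show ?thesis .
  qed
  then show ?thesis unfolding separated_sup_def
    using assms by (intro cSUP_upper bdd_aboveI2[where M="real N * exp B"]) auto
qed

lemma separated_sup_pos:
  assumes "n > 0" "\<epsilon> > 0" "continuous_on UNIV \<phi>"
  shows "separated_sup T \<phi> n \<epsilon> > 0"
proof -
  \<comment> \<open>Types are inhabited, so a singleton is available as a separated set with a
    positive sum.\<close>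
  have "(\<Sum>x\<in>{undefined}. exp (birkhoff_sum T \<phi> n x)) \<le> separated_sup T \<phi> n \<epsilon>"
    using assms by (intro separated_sup_upper) (auto simp: separated_def)
  then show ?thesis by (simp add: less_le_trans[OF exp_gt_zero])
qed

lemma separated_sup_least:
  assumes "\<And>E. finite E \<Longrightarrow> separated T n \<epsilon> E \<Longrightarrow> (\<Sum>x\<in>E. exp (birkhoff_sum T \<phi> n x)) \<le> c"
  shows "separated_sup T \<phi> n \<epsilon> \<le> c"
  unfolding separated_sup_def
proof (rule cSUP_least)
  have "{} \<in> {E. finite E \<and> separated T n \<epsilon> E}" by (simp add: separated_def)
  then show "{E. finite E \<and> separated T n \<epsilon> E} \<noteq> {}" by blast
qed (use assms in auto)

lemma pressure_at_antimono:
  assumes "0 < \<epsilon>" "\<epsilon> \<le> \<epsilon>'" "continuous_on UNIV \<phi>"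
  shows "pressure_at T \<phi> \<epsilon>' \<le> pressure_at T \<phi> \<epsilon>"
  unfolding pressure_at_def
proof (rule Limsup_mono, rule eventually_sequentiallyI[of 1])
  fix n :: nat assume n: "n \<ge> 1"
  have "separated_sup T \<phi> n \<epsilon>' \<le> separated_sup T \<phi> n \<epsilon>"
    using n assms by (intro separated_sup_least separated_sup_upper) (auto intro: separated_antimono)
  then show "ereal (ln (separated_sup T \<phi> n \<epsilon>') / real n) \<le> ereal (ln (separated_sup T \<phi> n \<epsilon>) / real n)"
    using n assms separated_sup_pos[of n \<epsilon>' \<phi>] by (simp add: divide_right_mono ln_mono)
qed

text \<open>Decreasing \<epsilon> admits more separated sets, so \<open>pressure_at\<close> is
  monotone and its one-sided limit exists as a supremum; only then does \<open>Lim\<close> have a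
  definite value.\<close>

lemma pressure_eq_SUP:
  assumes "continuous_on UNIV \<phi>"
  shows "pressure T \<phi> = (SUP \<epsilon>\<in>{0<..}. pressure_at T \<phi> \<epsilon>)"
proof -
  have "((\<lambda>\<epsilon>. pressure_at T \<phi> \<epsilon>) \<longlongrightarrow> (SUP \<epsilon>\<in>{0<..}. pressure_at T \<phi> \<epsilon>)) (at_right 0)"
  proof (rule order_tendstoI)
    fix a assume "a < (SUP \<epsilon>\<in>{0<..}. pressure_at T \<phi> \<epsilon>)"
    then obtain \<epsilon>' where "\<epsilon>' > 0" and a: "a < pressure_at T \<phi> \<epsilon>'" by (auto simp: less_SUP_iff)
    then have "\<forall>\<^sub>F \<epsilon> in at_right 0. \<epsilon> \<in> {0<..<\<epsilon>'}" by (intro eventually_at_right_real)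
    then show "\<forall>\<^sub>F \<epsilon> in at_right 0. a < pressure_at T \<phi> \<epsilon>"
      by eventually_elim (use a pressure_at_antimono[OF _ _ assms] in \<open>auto intro: less_le_trans\<close>)
  next
    fix a assume a: "(SUP \<epsilon>\<in>{0<..}. pressure_at T \<phi> \<epsilon>) < a"
    have "\<forall>\<^sub>F \<epsilon>::real in at_right 0. \<epsilon> \<in> {0<..<1}" by (intro eventually_at_right_real) simp
    then show "\<forall>\<^sub>F \<epsilon> in at_right 0. pressure_at T \<phi> \<epsilon> < a"
      by eventually_elim (use a in \<open>auto intro: le_less_trans[OF SUP_upper]\<close>)
  qed
  then show ?thesis
    unfolding pressure_def pressure_at_def[symmetric] by (intro tendsto_Lim) auto
qed

lemma pressure_at_le_pressure:
  "continuous_on UNIV \<phi> \<Longrightarrow> \<epsilon> > 0 \<Longrightarrow> pressure_at T \<phi> \<epsilon> \<le> pressure T \<phi>"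
  by (simp add: pressure_eq_SUP SUP_upper)

text \<open>Monotonicity, translation by constants and invariance under coboundaries in one statement.\<close>

lemma pressure_le_add:
  assumes \<phi>: "continuous_on UNIV \<phi>" and \<psi>: "continuous_on UNIV \<psi>"
    and le: "\<And>n x. birkhoff_sum T \<psi> n x \<le> birkhoff_sum T \<phi> n x + real n * c + K"
  shows "pressure T \<psi> \<le> pressure T \<phi> + ereal c"
proof -
  have "pressure_at T \<psi> \<epsilon> \<le> pressure T \<phi> + ereal c" if \<epsilon>: "\<epsilon> > 0" for \<epsilon>
  proof -
    \<comment> \<open>The bound on Birkhoff sums multiplies each partition sum by at most
      \<open>exp (real n * c + K)\<close>; after taking \<open>ln\<close> and dividing by
      \<open>n\<close> the constant \<open>K\<close> disappears in the limit.\<close>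
    have "pressure_at T \<psi> \<epsilon> \<le> limsup (\<lambda>n. ereal (c + K / real n) + ereal (ln (separated_sup T \<phi> n \<epsilon>) / real n))"
      unfolding pressure_at_def
    proof (rule Limsup_mono, rule eventually_sequentiallyI[of 1])
      fix n :: nat assume n: "n \<ge> 1"
      have "separated_sup T \<psi> n \<epsilon> \<le> exp (real n * c + K) * separated_sup T \<phi> n \<epsilon>"
      proof (rule separated_sup_least)
        fix E assume E: "finite E" "separated T n \<epsilon> E"
        have "(\<Sum>x\<in>E. exp (birkhoff_sum T \<psi> n x)) \<le> (\<Sum>x\<in>E. exp (real n * c + K) * exp (birkhoff_sum T \<phi> n x))"
          using le by (intro sum_mono) (simp add: exp_add[symmetric] algebra_simps)
        also have "\<dots> \<le> exp (real n * c + K) * separated_sup T \<phi> n \<epsilon>"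
          unfolding sum_distrib_left[symmetric]
          using n \<epsilon> \<phi> E by (intro mult_left_mono separated_sup_upper) auto
        finally show "(\<Sum>x\<in>E. exp (birkhoff_sum T \<psi> n x)) \<le> exp (real n * c + K) * separated_sup T \<phi> n \<epsilon>" .
      qed
      then have "ln (separated_sup T \<psi> n \<epsilon>) \<le> ln (exp (real n * c + K) * separated_sup T \<phi> n \<epsilon>)"
        using n \<epsilon> \<psi> separated_sup_pos[of n \<epsilon> \<psi>] by (intro ln_mono) auto
      also have "\<dots> = real n * c + K + ln (separated_sup T \<phi> n \<epsilon>)"
        using n \<epsilon> \<phi> separated_sup_pos[of n \<epsilon> \<phi>] by (simp add: ln_mult)
      finally show "ereal (ln (separated_sup T \<psi> n \<epsilon>) / real n)
          \<le> ereal (c + K / real n) + ereal (ln (separated_sup T \<phi> n \<epsilon>) / real n)"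
        using n divide_right_mono[of _ _ "real n"] by (fastforce simp: add_divide_distrib)
    qed
    also have "\<dots> = ereal c + pressure_at T \<phi> \<epsilon>"
      unfolding pressure_at_def
    proof (rule ereal_limsup_lim_add)
      have "(\<lambda>n. c + K / real n) \<longlonglongrightarrow> c + 0"
        by (intro tendsto_intros lim_const_over_n)
      then show "(\<lambda>n. ereal (c + K / real n)) \<longlonglongrightarrow> ereal c" by simp
    qed simp
    also have "\<dots> \<le> pressure T \<phi> + ereal c"
      using pressure_at_le_pressure[OF \<phi> \<epsilon>] by (simp add: add.commute add_mono)
    finally show ?thesis .
  qed
  then show ?thesis by (auto simp: pressure_eq_SUP[OF \<psi>] intro!: SUP_least)
qed

end

subsection \<open>The Jordan decomposition\<close>

locale signed_borel_measure =
  fixes \<nu> :: "'a::topological_space set \<Rightarrow> real"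
  assumes sums_UN: "range A \<subseteq> sets borel \<Longrightarrow> disjoint_family A \<Longrightarrow> (\<lambda>n. \<nu> (A n)) sums \<nu> (\<Union>n. A n)"
begin

lemma empty: "\<nu> {} = 0"
proof -
  have "summable (\<lambda>n::nat. \<nu> {})" using sums_UN[of "\<lambda>_. {}"] by (auto simp: sums_iff disjoint_family_on_def)
  then show ?thesis by (simp add: summable_const_iff)
qed

lemma additive:
  assumes "A \<in> sets borel" "B \<in> sets borel" "A \<inter> B = {}"
  shows "\<nu> (A \<union> B) = \<nu> A + \<nu> B"
proof -
  have "(\<lambda>n. \<nu> (binaryset A B n)) sums \<nu> (\<Union>n. binaryset A B n)"
    using assms by (intro sums_UN) (auto simp: range_binaryset_eq disjoint_family_on_def binaryset_def)
  moreover have "(\<lambda>n. \<nu> (binaryset A B n)) sums (\<nu> A + \<nu> B)"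
    using binaryset_sums[of \<nu> A B] empty by blast
  ultimately show ?thesis by (metis sums_unique2 UN_binaryset_eq)
qed

lemma diff:
  assumes "A \<in> sets borel" "B \<in> sets borel" "B \<subseteq> A"
  shows "\<nu> (A - B) = \<nu> A - \<nu> B"
  using additive[of B "A - B"] assms by (auto simp: Un_absorb1)

lemma signed_borel_measure_uminus: "signed_borel_measure (\<lambda>A. - \<nu> A)"
  by unfold_locales (intro sums_minus sums_UN)

text \<open>
  If \<open>\<nu>\<close> were unbounded on the subsets of \<open>A\<close>, one could repeatedly split off a set of measure at
  least 1 in absolute value, keeping \<open>\<nu>\<close> unbounded on the rest.
\<close>

lemma bounded: obtains C where "\<And>B. B \<in> sets borel \<Longrightarrow> \<bar>\<nu> B\<bar> \<le> C"
proof (rule ccontr)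
  assume not: "\<not> thesis"
  define bad where "bad A \<longleftrightarrow> A \<in> sets borel \<and> (\<forall>C. \<exists>B\<in>sets borel. B \<subseteq> A \<and> \<bar>\<nu> B\<bar> > C)" for A
  have step: "\<exists>A'. bad A' \<and> A' \<subseteq> A \<and> \<bar>\<nu> (A - A')\<bar> \<ge> 1" if A: "bad A" for A
  proof -
    \<comment> \<open>The margin makes either piece fit to be split off: \<open>\<nu> B\<close>
      exceeds 1 in absolute value, and so does
      \<open>\<nu> (A - B) = \<nu> A - \<nu> B\<close>.\<close>
    obtain B where B: "B \<in> sets borel" "B \<subseteq> A" "\<bar>\<nu> B\<bar> > \<bar>\<nu> A\<bar> + 1"
      using A unfolding bad_def by blast
    have mA: "A \<in> sets borel" using A by (simp add: bad_def)
    \<comment> \<open>Bounds \<open>C1\<close> and \<open>C2\<close> on the two pieces would add up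
      to a bound on \<open>A\<close>.\<close>
    have "bad B \<or> bad (A - B)"
    proof (rule ccontr)
      assume "\<not> ?thesis"
      then have "\<not> bad B" "\<not> bad (A - B)" by auto
      obtain C1 where C1: "\<And>D. D \<in> sets borel \<Longrightarrow> D \<subseteq> B \<Longrightarrow> \<bar>\<nu> D\<bar> \<le> C1"
        using \<open>\<not> bad B\<close> B by (auto simp: bad_def not_less)
      obtain C2 where C2: "\<And>D. D \<in> sets borel \<Longrightarrow> D \<subseteq> A - B \<Longrightarrow> \<bar>\<nu> D\<bar> \<le> C2"
        using \<open>\<not> bad (A - B)\<close> B mA by (auto simp: bad_def not_less)
      obtain D where D: "D \<in> sets borel" "D \<subseteq> A" "\<bar>\<nu> D\<bar> > C1 + C2"
        using A unfolding bad_def by blast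
      have "\<nu> D = \<nu> (D \<inter> B) + \<nu> (D - B)"
        using additive[of "D \<inter> B" "D - B"] B D by (simp add: Int_Diff_Un Diff_disjoint Int_Diff_disjoint)
      moreover have "\<bar>\<nu> (D \<inter> B)\<bar> \<le> C1" "\<bar>\<nu> (D - B)\<bar> \<le> C2" using B D by (auto intro!: C1 C2)
      ultimately show False using D by linarith
    qed
    then show ?thesis
    proof
      assume "bad B"
      moreover have "\<bar>\<nu> (A - B)\<bar> \<ge> 1" using diff[of A B] mA B by linarith
      ultimately show ?thesis using B by blast
    next
      assume "bad (A - B)"
      moreover have "A - (A - B) = B" using B by blast
      ultimately show ?thesis using B by (intro exI[of _ "A - B"]) auto
    qed
  qed
  have "bad UNIV"
  proof (rule ccontr)
    assume "\<not> bad UNIV"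
    then obtain C where "\<And>B. B \<in> sets borel \<Longrightarrow> \<bar>\<nu> B\<bar> \<le> C" by (auto simp: bad_def not_less)
    then show False using not that[of C] by blast
  qed
  then obtain A where A: "\<And>n. bad (A n)" "\<And>n. A (Suc n) \<subseteq> A n" "\<And>n. \<bar>\<nu> (A n - A (Suc n))\<bar> \<ge> 1"
    using dependent_nat_choice[of "\<lambda>_. bad" "\<lambda>_ A A'. A' \<subseteq> A \<and> \<bar>\<nu> (A - A')\<bar> \<ge> 1"] step by metis
  have dec: "A n \<subseteq> A m" if "m \<le> n" for m n using A(2) that by (rule lift_Suc_antimono_le)
  have dis: "disjoint_family (\<lambda>n. A n - A (Suc n))"
  proof -
    have "(A m - A (Suc m)) \<inter> (A n - A (Suc n)) = {}" if "m < n" for m n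
      using dec[of "Suc m" n] that by auto
    then show ?thesis unfolding disjoint_family_on_def by (metis Int_commute linorder_neqE_nat)
  qed
  \<comment> \<open>The pieces split off are disjoint, so countable additivity makes their measures
    tend to 0, against the lower bound 1.\<close>
  have "(\<lambda>n. \<nu> (A n - A (Suc n))) sums \<nu> (\<Union>n. A n - A (Suc n))"
    using A(1) by (intro sums_UN dis) (auto simp: bad_def)
  then have "(\<lambda>n. \<nu> (A n - A (Suc n))) \<longlonglongrightarrow> 0" by (intro summable_LIMSEQ_zero) (rule sums_summable)
  then have "\<forall>\<^sub>F n in sequentially. \<bar>\<nu> (A n - A (Suc n))\<bar> < 1"
    by (metis (no_types) order_tendstoD(2) tendsto_rabs_zero zero_less_one)
  then show False using A(3) by (auto simp: eventually_sequentially not_less[symmetric])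
qed

text \<open>The real-valued form of the supremum in \<open>jordan_pos\<close>;
  \<open>bounded\<close> makes it finite and so allows real arithmetic.\<close>

definition pos :: "'a set \<Rightarrow> real" where
  "pos A = (SUP B\<in>{B\<in>sets borel. B \<subseteq> A}. \<nu> B)"

lemma pos_upper:
  assumes "B \<in> sets borel" "B \<subseteq> A"
  shows "\<nu> B \<le> pos A"
proof -
  obtain C where "\<And>B. B \<in> sets borel \<Longrightarrow> \<bar>\<nu> B\<bar> \<le> C" by (rule bounded, rule that)
  then have "\<And>B. B \<in> sets borel \<Longrightarrow> \<nu> B \<le> C" by (simp add: abs_le_iff)
  then show ?thesis unfolding pos_def using assms by (intro cSUP_upper bdd_aboveI2[where M=C]) auto
qed

lemma pos_least:
  assumes "\<And>B. B \<in> sets borel \<Longrightarrow> B \<subseteq> A \<Longrightarrow> \<nu> B \<le> c"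
  shows "pos A \<le> c"
  unfolding pos_def
proof (rule cSUP_least)
  have "{} \<in> {B \<in> sets borel. B \<subseteq> A}" by simp
  then show "{B \<in> sets borel. B \<subseteq> A} \<noteq> {}" by blast
qed (use assms in auto)

lemma pos_nonneg: "0 \<le> pos A"
  using pos_upper[of "{}" A] by (simp add: empty)

lemma pos_empty: "pos {} = 0"
  using pos_nonneg[of "{}"] pos_least[of "{}" 0] by (force simp: empty)

lemma pos_mono: "A \<subseteq> B \<Longrightarrow> pos A \<le> pos B"
  by (intro pos_least pos_upper) auto

lemma pos_superadditive:
  assumes "A \<in> sets borel" "B \<in> sets borel" "A \<inter> B = {}"
  shows "pos A + pos B \<le> pos (A \<union> B)"
proof -
  have "pos A \<le> pos (A \<union> B) - pos B"
  proof (rule pos_least)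
    fix C assume C: "C \<in> sets borel" "C \<subseteq> A"
    have "pos B \<le> pos (A \<union> B) - \<nu> C"
    proof (rule pos_least)
      fix D assume D: "D \<in> sets borel" "D \<subseteq> B"
      have "\<nu> C + \<nu> D = \<nu> (C \<union> D)" using C D assms by (intro additive[symmetric]) auto
      also have "\<dots> \<le> pos (A \<union> B)" using C D by (intro pos_upper) auto
      finally show "\<nu> D \<le> pos (A \<union> B) - \<nu> C" by simp
    qed
    then show "\<nu> C \<le> pos (A \<union> B) - pos B" by simp
  qed
  then show ?thesis by simp
qed

text \<open>Superadditivity bounds the partial sums from above. Conversely, a set \<open>B\<close>
  inside the union splits into the pieces \<open>B \<inter> A n\<close>, to which countable
  additivity of \<nu> applies.\<close>

lemma pos_sums:
  assumes A: "range A \<subseteq> sets borel" and dis: "disjoint_family A"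
  shows "(\<lambda>n. pos (A n)) sums pos (\<Union>n. A n)"
proof -
  have fin: "(\<Sum>i<n. pos (A i)) \<le> pos (\<Union>i<n. A i)" for n
  proof (induction n)
    case (Suc n)
    have "A i \<inter> A n = {}" if "i < n" for i using dis that by (simp add: disjoint_family_on_def)
    then have "(\<Union>i<n. A i) \<inter> A n = {}" by auto
    then have "pos (\<Union>i<n. A i) + pos (A n) \<le> pos ((\<Union>i<n. A i) \<union> A n)"
      using A by (intro pos_superadditive) auto
    then show ?case using Suc by (simp add: lessThan_Suc Un_commute)
  qed (simp add: pos_empty)
  have le: "(\<Sum>i<n. pos (A i)) \<le> pos (\<Union>n. A n)" for n
    by (rule order_trans[OF fin]) (intro pos_mono; blast)
  have sm: "summable (\<lambda>n. pos (A n))" using le pos_nonneg by (intro summableI_nonneg_bounded)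
  have "pos (\<Union>n. A n) \<le> (\<Sum>n. pos (A n))"
  proof (rule pos_least)
    fix B assume B: "B \<in> sets borel" "B \<subseteq> (\<Union>n. A n)"
    have "(\<lambda>n. \<nu> (B \<inter> A n)) sums \<nu> (\<Union>n. B \<inter> A n)"
      using A B dis by (intro sums_UN) (auto simp: disjoint_family_on_def disjoint_iff)
    moreover have "(\<Union>n. B \<inter> A n) = B" using B by blast
    moreover have "\<nu> (B \<inter> A n) \<le> pos (A n)" for n using A B by (intro pos_upper) auto
    ultimately show "\<nu> B \<le> (\<Sum>n. pos (A n))" using sums_le[OF _ _ summable_sums[OF sm]] by metis
  qed
  moreover have "(\<Sum>n. pos (A n)) \<le> pos (\<Union>n. A n)" using le sm by (rule suminf_le_const[rotated])
  ultimately show ?thesis using sm by (simp add: sums_iff)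
qed

lemma sets_jordan_pos: "sets (jordan_pos \<nu>) = sets borel"
  unfolding jordan_pos_def using sets.sigma_sets_eq[of "borel :: 'a measure"] by simp

text \<open>\<open>measure_of\<close> returns the given set function only if it is a measure;
  \<open>pos_sums\<close> provides this once the two suprema are identified.\<close>

lemma emeasure_jordan_pos:
  assumes "A \<in> sets borel"
  shows "emeasure (jordan_pos \<nu>) A = ennreal (pos A)"
proof -
  have eq: "(SUP B\<in>{B\<in>sets borel. B \<subseteq> A}. ennreal (\<nu> B)) = ennreal (pos A)" for A
  proof (rule antisym)
    show "(SUP B\<in>{B\<in>sets borel. B \<subseteq> A}. ennreal (\<nu> B)) \<le> ennreal (pos A)"
      by (intro SUP_least ennreal_leI pos_upper) auto
    have le: "ennreal (pos A) \<le> S" if S: "\<And>B. B \<in> sets borel \<Longrightarrow> B \<subseteq> A \<Longrightarrow> ennreal (\<nu> B) \<le> S" for S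
    proof (cases S)
      case (real r)
      then have "\<nu> B \<le> r" if "B \<in> sets borel" "B \<subseteq> A" for B
        using S[OF that] by (simp add: ennreal_le_iff)
      then show ?thesis using pos_least[of A r] real by (simp add: ennreal_leI)
    qed simp
    show "ennreal (pos A) \<le> (SUP B\<in>{B\<in>sets borel. B \<subseteq> A}. ennreal (\<nu> B))"
      by (rule le) (rule SUP_upper, simp)
  qed
  show ?thesis
  proof (rule emeasure_measure_of[of _ UNIV "sets borel"])
    show "jordan_pos \<nu> = measure_of UNIV (sets borel) (\<lambda>A. ennreal (pos A))"
      unfolding jordan_pos_def eq ..
    show "positive (sets (jordan_pos \<nu>)) (\<lambda>A. ennreal (pos A))"
      by (simp add: positive_def pos_empty)
    show "countably_additive (sets (jordan_pos \<nu>)) (\<lambda>A. ennreal (pos A))"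
      unfolding countably_additive_def sets_jordan_pos
      using pos_sums pos_nonneg by (auto simp: sums_iff suminf_ennreal2)
    show "A \<in> sets (jordan_pos \<nu>)" using assms by (simp add: sets_jordan_pos)
  qed simp
qed

lemma measure_jordan_pos: "A \<in> sets borel \<Longrightarrow> measure (jordan_pos \<nu>) A = pos A"
  by (simp add: measure_def emeasure_jordan_pos pos_nonneg)

lemma finite_measure_jordan_pos: "finite_measure (jordan_pos \<nu>)"
  using sets_eq_imp_space_eq[OF sets_jordan_pos]
  by (intro finite_measureI) (simp add: emeasure_jordan_pos)

lemma pos_eq_if_nonneg:
  assumes "\<And>B. B \<in> sets borel \<Longrightarrow> 0 \<le> \<nu> B" "A \<in> sets borel"
  shows "pos A = \<nu> A"
proof (intro antisym pos_least pos_upper)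
  fix B assume "B \<in> sets borel" "B \<subseteq> A"
  then show "\<nu> B \<le> \<nu> A" using diff[of A B] assms(1)[of "A - B"] assms by auto
qed (use assms in auto)

text \<open>Complementation inside \<open>A\<close>, through
  \<open>\<nu> B = \<nu> A - \<nu> (A - B)\<close>, compares the suprema of \<nu> and of its
  negative in both directions.\<close>

lemma jordan_decomposition:
  assumes "A \<in> sets borel"
  shows "\<nu> A = measure (jordan_pos \<nu>) A - measure (jordan_pos (\<lambda>A. - \<nu> A)) A"
proof -
  interpret m: signed_borel_measure "\<lambda>A. - \<nu> A" by (rule signed_borel_measure_uminus)
  have "pos A \<le> \<nu> A + m.pos A"
  proof (rule pos_least)
    fix B assume B: "B \<in> sets borel" "B \<subseteq> A"
    then show "\<nu> B \<le> \<nu> A + m.pos A" using diff[of A B] m.pos_upper[of "A - B" A] assms by auto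
  qed
  moreover have "m.pos A \<le> pos A - \<nu> A"
  proof (rule m.pos_least)
    fix B assume B: "B \<in> sets borel" "B \<subseteq> A"
    then show "- \<nu> B \<le> pos A - \<nu> A" using diff[of A B] pos_upper[of "A - B" A] assms by auto
  qed
  ultimately show ?thesis using assms by (simp add: measure_jordan_pos m.measure_jordan_pos)
qed

end

subsection \<open>Subgradients of the pressure are invariant probability measures\<close>

lemma signed_integral_minus: "signed_integral \<nu> (\<lambda>x. - f x) = - signed_integral \<nu> f"
  by (simp add: signed_integral_def)

lemma invariant_measureD:
  assumes "M \<in> invariant_measures T"
  shows "prob_space M" "finite_measure M" "sets M = sets borel" "space M = UNIV" "distr M borel T = M"
  using assms sets_eq_imp_space_eq[of M borel] prob_space.finite_measure[of M]
  by (auto simp: invariant_measures_def)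

context compact_system
begin

lemma measurable_T: "T \<in> borel_measurable borel"
  by (rule borel_measurable_continuous_onI[OF continuous_T])

lemma continuous_compose_T: "continuous_on UNIV f \<Longrightarrow> continuous_on UNIV (\<lambda>x. f (T x))"
  by (rule continuous_on_compose2[OF _ continuous_T]) auto

lemma birkhoff_sum_coboundary:
  "birkhoff_sum T (\<lambda>x. f (T x) - f x) n x = (f ((T ^^ n) x) - f x :: real)"
  unfolding birkhoff_sum_def by (induction n) simp_all

text \<open>The subgradient inequality at \<open>\<phi> + f\<close> and
  \<open>pressure_le_add\<close> combine; finiteness of the pressure of \<phi> allows cancellation.
  A bounded error \<open>K\<close> in the Birkhoff sums is harmless, which admits
  coboundaries.\<close>

lemma subgradient_le:
  assumes \<nu>: "\<nu> \<in> pressure_subdifferential T \<phi>"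
    and \<phi>: "continuous_on UNIV \<phi>" "\<bar>pressure T \<phi>\<bar> \<noteq> \<infinity>"
    and f: "continuous_on UNIV f" "\<And>n x. birkhoff_sum T f n x \<le> real n * c + K"
  shows "signed_integral \<nu> f \<le> c"
proof -
  have cont: "continuous_on UNIV (\<lambda>x. \<phi> x + f x)" using \<phi> f by (intro continuous_intros)
  have "pressure T \<phi> + ereal (signed_integral \<nu> (\<lambda>x. \<phi> x + f x - \<phi> x)) \<le> pressure T (\<lambda>x. \<phi> x + f x)"
    using \<nu> cont unfolding pressure_subdifferential_def by blast
  also have "\<dots> \<le> pressure T \<phi> + ereal c"
    using f(2) by (intro pressure_le_add[OF \<phi>(1) cont, where K=K])
      (simp add: birkhoff_sum_def sum.distrib add.assoc)
  finally show ?thesis using \<phi>(2) by (cases "pressure T \<phi>") auto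
qed

text \<open>Three uses of \<open>subgradient_le\<close>: nonpositive functions give positivity, the
  constants 1 and -1 give mass 1, and coboundaries give invariance. Positivity reaches compact sets
  through bumps and all Borel sets through inner regularity.\<close>

lemma subgradient_is_invariant_measure:
  assumes \<nu>: "\<nu> \<in> pressure_subdifferential T \<phi>"
    and \<phi>: "continuous_on UNIV \<phi>" "\<bar>pressure T \<phi>\<bar> \<noteq> \<infinity>"
  obtains M where "M \<in> invariant_measures T" "\<nu> = measure M"
proof -
  have rad: "\<nu> \<in> signed_radon_measures" using \<nu> by (simp add: pressure_subdifferential_def)
  interpret signed_borel_measure \<nu>
    using rad by unfold_locales (simp add: signed_radon_measures_def)
  interpret m: signed_borel_measure "\<lambda>A. - \<nu> A" by (rule signed_borel_measure_uminus)
  note le = subgradient_le[OF \<nu> \<phi>]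
  have nonneg: "0 \<le> signed_integral \<nu> f" if "continuous_on UNIV f" "\<And>x. 0 \<le> f x" for f
  proof -
    have "signed_integral \<nu> (\<lambda>x. - f x) \<le> 0"
      using that by (intro le[where K=0] continuous_intros) (auto simp: birkhoff_sum_def sum_negf sum_nonneg)
    then show ?thesis by (simp add: signed_integral_minus)
  qed
  have compact_nonneg: "0 \<le> \<nu> K" if K: "compact K" for K
  proof (cases "K = {}")
    case False
    have "(\<lambda>k. signed_integral \<nu> (bump K k)) \<longlonglongrightarrow> measure (jordan_pos \<nu>) K - measure (jordan_pos (\<lambda>A. - \<nu> A)) K"
      unfolding signed_integral_def using K False compact_imp_closed
      by (intro tendsto_diff integral_bump_tendsto finite_measure_jordan_pos m.finite_measure_jordan_pos
          sets_jordan_pos m.sets_jordan_pos) auto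
    moreover have "0 \<le> signed_integral \<nu> (bump K k)" for k
      by (intro nonneg continuous_bump bump_nonneg)
    ultimately have "0 \<le> measure (jordan_pos \<nu>) K - measure (jordan_pos (\<lambda>A. - \<nu> A)) K"
      by (intro LIMSEQ_le_const) auto
    then show ?thesis using jordan_decomposition[of K] compact_imp_closed[OF K] by simp
  qed (simp add: empty)
  have inner: "\<forall>A\<in>sets borel. \<forall>e>0. \<exists>K. compact K \<and> K \<in> sets borel \<and> K \<subseteq> A \<and>
      (\<forall>B\<in>sets borel. B \<subseteq> A - K \<longrightarrow> \<bar>\<nu> B\<bar> < e)"
    using rad by (simp add: signed_radon_measures_def)
  have \<nu>_nonneg: "0 \<le> \<nu> A" if A: "A \<in> sets borel" for A
  proof (rule field_le_epsilon)
    fix e :: real assume "e > 0"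
    from inner[rule_format, OF A this]
    obtain K where K: "compact K" "K \<in> sets borel" "K \<subseteq> A" "\<And>B. B \<in> sets borel \<Longrightarrow> B \<subseteq> A - K \<Longrightarrow> \<bar>\<nu> B\<bar> < e"
      by blast
    have "\<bar>\<nu> (A - K)\<bar> < e" using K A by simp
    then show "0 \<le> \<nu> A + e" using diff[OF A K(2,3)] compact_nonneg[OF K(1)] by linarith
  qed
  define M where "M = jordan_pos \<nu>"
  have M: "finite_measure M" "sets M = sets borel"
    by (simp_all add: M_def finite_measure_jordan_pos sets_jordan_pos)
  have sp: "space M = UNIV" using sets_eq_imp_space_eq[OF M(2)] by simp
  have \<nu>M: "\<nu> = measure M"
  proof
    fix A
    show "\<nu> A = measure M A"
    proof (cases "A \<in> sets borel")
      case True
      then show ?thesis using pos_eq_if_nonneg[OF \<nu>_nonneg True] by (simp add: M_def measure_jordan_pos)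
    next
      case False
      then have "\<nu> A = 0" using rad by (simp add: signed_radon_measures_def)
      then show ?thesis using False by (simp add: measure_notin_sets M(2))
    qed
  qed
  have si: "signed_integral \<nu> f = (\<integral>x. f x \<partial>M)" for f
    unfolding \<nu>M by (rule signed_integral_measure[OF M])
  have "measure M (space M) = 1"
  proof -
    have "signed_integral \<nu> (\<lambda>_. 1) \<le> 1" by (intro le[where K=0]) (auto simp: birkhoff_sum_def)
    moreover have "signed_integral \<nu> (\<lambda>_. - 1) \<le> - 1" by (intro le[where K=0]) (auto simp: birkhoff_sum_def)
    ultimately show ?thesis by (simp add: si)
  qed
  then have prob: "prob_space M"
    using M(1) by (intro prob_spaceI) (simp add: finite_measure.emeasure_eq_measure)
  have T: "T \<in> measurable M borel" using measurable_T by (simp cong: measurable_cong_sets add: M)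
  \<comment> \<open>The Birkhoff sums of a coboundary telescope and stay below \<open>2 * B\<close>,
    so \<open>c = 0\<close>. One inequality suffices because \<open>prob_eq_if_integral_le\<close>
    compares two probability measures.\<close>
  have inv: "(\<integral>x. f (T x) \<partial>M) \<le> (\<integral>x. f x \<partial>M)" if f: "continuous_on UNIV f" for f :: "'a \<Rightarrow> real"
  proof -
    obtain B where B: "\<And>x. \<bar>f x\<bar> \<le> B" by (rule bounded_continuous[OF f], rule that)
    have "signed_integral \<nu> (\<lambda>x. f (T x) - f x) \<le> 0"
    proof (rule le[where K="2 * B"])
      show "birkhoff_sum T (\<lambda>x. f (T x) - f x) n x \<le> real n * 0 + 2 * B" for n x
        using B[of "(T ^^ n) x"] B[of x] by (simp add: birkhoff_sum_coboundary)
    qed (intro continuous_intros continuous_compose_T f)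
    also have "signed_integral \<nu> (\<lambda>x. f (T x) - f x) = (\<integral>x. f (T x) \<partial>M) - (\<integral>x. f x \<partial>M)"
      unfolding si by (intro Bochner_Integration.integral_diff integrable_continuous_compact[OF compact_space M]
          continuous_compose_T f)
    finally show ?thesis by simp
  qed
  have "distr M borel T = M"
  proof (rule prob_eq_if_integral_le)
    fix F :: "'a set" and k
    have "bump F k \<in> borel_measurable borel" by (rule borel_measurable_continuous_onI[OF continuous_bump])
    then have "(\<integral>x. bump F k x \<partial>distr M borel T) = (\<integral>x. bump F k (T x) \<partial>M)"
      by (intro integral_distr T)
    also have "\<dots> \<le> (\<integral>x. bump F k x \<partial>M)" by (intro inv continuous_bump)
    finally show "(\<integral>x. bump F k x \<partial>distr M borel T) \<le> (\<integral>x. bump F k x \<partial>M)" .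
  qed (use prob M T prob_space.prob_space_distr in auto)
  then have "M \<in> invariant_measures T" using prob M by (simp add: invariant_measures_def)
  with \<nu>M that show ?thesis by blast
qed

end

subsection \<open>Positive parts of Birkhoff averages\<close>

context compact_system
begin

section \<open>Integrals against invariant measures\<close>

lemma integrable_invariant:
  fixes f :: "'a \<Rightarrow> real"
  shows "M \<in> invariant_measures T \<Longrightarrow> continuous_on UNIV f \<Longrightarrow> integrable M f"
  by (intro integrable_continuous_compact[OF compact_space] invariant_measureD(2,3))

lemma integral_compose_T:
  fixes f :: "'a \<Rightarrow> real"
  assumes "M \<in> invariant_measures T" "f \<in> borel_measurable borel"
  shows "(\<integral>x. f (T x) \<partial>M) = (\<integral>x. f x \<partial>M)"
proof -
  have "T \<in> measurable M borel"
    using measurable_T by (simp cong: measurable_cong_sets add: invariant_measureD(3)[OF assms(1)])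
  then have "(\<integral>x. f x \<partial>distr M borel T) = (\<integral>x. f (T x) \<partial>M)" by (intro integral_distr assms)
  then show ?thesis by (simp add: invariant_measureD(5)[OF assms(1)])
qed

lemma integral_birkhoff_sum:
  assumes M: "M \<in> invariant_measures T" and f: "continuous_on UNIV f"
  shows "(\<integral>x. birkhoff_sum T f n x \<partial>M) = real n * (\<integral>x. f x \<partial>M)"
proof -
  have "(\<integral>x. f ((T ^^ k) x) \<partial>M) = (\<integral>x. f x \<partial>M)" for k
  proof (induction k)
    case (Suc k)
    have "(\<integral>x. f ((T ^^ k) (T x)) \<partial>M) = (\<integral>x. f ((T ^^ k) x) \<partial>M)"
      using continuous_compose_iterate[OF f]
      by (intro integral_compose_T[OF M] borel_measurable_continuous_onI)
    then show ?case using Suc by (simp add: funpow_swap1)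
  qed simp
  then show ?thesis unfolding birkhoff_sum_def
    by (subst Bochner_Integration.integral_sum) (simp_all add: integrable_invariant[OF M continuous_compose_iterate[OF f]])
qed

text \<open>
  With \<open>m n = max\<^bsub>1 \<le> k \<le> n + 1\<^esub> S\<^sub>k g\<close>, the differences \<open>m (n + 1) - m n \<circ> T\<close> have a nonnegative
  integral over the invariant set where the sums are unbounded above, and they tend to \<open>g\<close> there.
\<close>

lemma birkhoff_sums_bounded_above:
  assumes erg: "ergodic T \<mu>" and g: "continuous_on UNIV g" and neg: "(\<integral>x. g x \<partial>\<mu>) < 0"
  shows "AE x in \<mu>. \<exists>C. \<forall>n. birkhoff_sum T g n x \<le> C"
proof -
  have \<mu>: "\<mu> \<in> invariant_measures T" using erg by (simp add: ergodic_def)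
  interpret prob_space \<mu> using invariant_measureD(1)[OF \<mu>] .
  note sets = invariant_measureD(3)[OF \<mu>] and sp = invariant_measureD(4)[OF \<mu>]
  \<comment> \<open>The aim is that \<open>A\<close> is null: it is invariant, so ergodicity leaves
    only measure 0 or 1, and measure 1 would make the integral of \<open>g\<close>
    nonnegative.\<close>
  define A where "A = {x. \<forall>C. \<exists>n. birkhoff_sum T g n x > C}"
  have A_eq: "A = (\<Inter>C::nat. \<Union>n. {x. real C < birkhoff_sum T g n x})"
  proof safe
    fix x and C :: nat assume "x \<in> A"
    then show "x \<in> (\<Union>n. {x. real C < birkhoff_sum T g n x})" by (auto simp: A_def)
  next
    fix x assume x: "x \<in> (\<Inter>C::nat. \<Union>n. {x. real C < birkhoff_sum T g n x})"
    show "x \<in> A" unfolding A_def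
    proof safe
      fix C :: real
      obtain k :: nat where "C < real k" using reals_Archimedean2 by blast
      moreover obtain n where "real k < birkhoff_sum T g n x" using x by auto
      ultimately show "\<exists>n. C < birkhoff_sum T g n x" by (auto intro: less_trans)
    qed
  qed
  have "{x. real C < birkhoff_sum T g n x} \<in> sets borel" for C :: nat and n
    by (intro borel_open open_Collect_less continuous_intros continuous_birkhoff_sum g)
  then have A: "A \<in> sets borel" unfolding A_eq by auto
  have inv: "T x \<in> A \<longleftrightarrow> x \<in> A" for x
  proof
    assume Tx: "T x \<in> A"
    show "x \<in> A" unfolding A_def
    proof safe
      fix C
      obtain n where "C - g x < birkhoff_sum T g n (T x)" using Tx by (auto simp: A_def)
      then show "\<exists>n. C < birkhoff_sum T g n x"
        by (intro exI[of _ "Suc n"]) (simp add: birkhoff_sum_Suc)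
    qed
  next
    assume x: "x \<in> A"
    show "T x \<in> A" unfolding A_def
    proof safe
      fix C
      \<comment> \<open>The maximum with 0 excludes \<open>n = 0\<close>, where the sum vanishes, so
        that one step can be removed.\<close>
      obtain n where n: "max 0 (C + g x) < birkhoff_sum T g n x" using x unfolding A_def by blast
      then obtain k where "n = Suc k" by (cases n) (auto simp: birkhoff_sum_def)
      then show "\<exists>n. C < birkhoff_sum T g n (T x)"
        using n by (intro exI[of _ k]) (simp add: birkhoff_sum_Suc)
    qed
  qed
  \<comment> \<open>The recursion computes the maximum of the first \<open>n + 1\<close> nonempty
    Birkhoff sums: each is \<open>g x\<close> plus a possibly empty sum started at
    \<open>T x\<close>, and the empty one accounts for the 0.\<close>
  define m where "m = rec_nat g (\<lambda>_ h x. g x + max 0 (h (T x)))"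
  have m0: "m 0 x = g x" and mS: "m (Suc n) x = g x + max 0 (m n (T x))" for n x
    by (simp_all add: m_def)
  have m_cont: "continuous_on UNIV (m n)" for n
  proof (induction n)
    case (Suc n)
    have "m (Suc n) = (\<lambda>x. g x + max 0 (m n (T x)))" using mS by blast
    then show ?case by (simp add: continuous_intros g continuous_compose_T[OF Suc])
  qed (simp add: m_def g)
  have m_Suc: "m n x \<le> m (Suc n) x" for n x
  proof (induction n arbitrary: x)
    case (Suc n)
    have "max 0 (m n (T x)) \<le> max 0 (m (Suc n) (T x))" using Suc[of "T x"] by linarith
    then show ?case by (subst (1 2) mS) simp
  qed (simp add: m0 mS)
  have m_mono: "m k x \<le> m n x" if "k \<le> n" for k n x
    using that by (rule lift_Suc_mono_le[of "\<lambda>n. m n x", OF m_Suc])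
  have m_ge: "birkhoff_sum T g (Suc n) x \<le> m n x" for n x
  proof (induction n arbitrary: x)
    case (Suc n)
    then show ?case using Suc[of "T x"] by (simp add: birkhoff_sum_Suc[of T g "Suc n"] mS le_max_iff_disj)
  qed (simp add: m0 birkhoff_sum_def)
  obtain B where B: "B \<ge> 0" "\<And>x. \<bar>g x\<bar> \<le> B" by (rule bounded_continuous[OF g], rule that)
  have meas: "f \<in> borel_measurable \<mu>" if "continuous_on UNIV f" for f :: "'a \<Rightarrow> real"
    using borel_measurable_continuous_onI[OF that] by (simp cong: measurable_cong_sets add: sets)
  have int: "integrable \<mu> (\<lambda>x. indicator A x * f x)" if "continuous_on UNIV f" for f :: "'a \<Rightarrow> real"
    using integrable_real_mult_indicator[of A \<mu> f] A integrable_invariant[OF \<mu> that]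
    by (simp add: sets mult.commute)
  define d where "d n x = indicator A x * m (Suc n) x - indicator A x * m n (T x)" for n x
  \<comment> \<open>By invariance of \<open>A\<close> and of \<mu>, \<open>m n\<close> and its
    composition with \<open>T\<close> have the same integral over \<open>A\<close>; so the integral
    of \<open>d n\<close> is that of the increment of \<open>m\<close> over
    \<open>A\<close>.\<close>
  have d_nonneg: "0 \<le> (\<integral>x. d n x \<partial>\<mu>)" for n
  proof -
    have "(\<integral>x. indicator A x * m n (T x) \<partial>\<mu>) = (\<integral>x. indicator A (T x) * m n (T x) \<partial>\<mu>)"
      using inv by (simp add: indicator_def)
    also have "\<dots> = (\<integral>x. indicator A x * m n x \<partial>\<mu>)"
      using A borel_measurable_continuous_onI[OF m_cont[of n]]
      by (intro integral_compose_T[OF \<mu>] borel_measurable_times borel_measurable_indicator)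
    also have "\<dots> \<le> (\<integral>x. indicator A x * m (Suc n) x \<partial>\<mu>)"
      using m_Suc by (intro integral_mono int m_cont mult_left_mono) auto
    finally show ?thesis unfolding d_def
      by (subst Bochner_Integration.integral_diff) (auto intro: int[OF m_cont] int[OF continuous_compose_T[OF m_cont]])
  qed
  have "(\<lambda>n. \<integral>x. d n x \<partial>\<mu>) \<longlonglongrightarrow> (\<integral>x. indicator A x * g x \<partial>\<mu>)"
  proof (rule integral_dominated_convergence[where w="\<lambda>_. 2 * B"])
    show "(\<lambda>x. indicator A x * g x) \<in> borel_measurable \<mu>" using int[OF g] by simp
    show "d n \<in> borel_measurable \<mu>" for n
      unfolding d_def[abs_def] using int[OF m_cont[of "Suc n"]] int[OF continuous_compose_T[OF m_cont[of n]]] by simp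
    show "AE x in \<mu>. (\<lambda>n. d n x) \<longlonglongrightarrow> indicator A x * g x"
    proof (rule AE_I2)
      fix x
      show "(\<lambda>n. d n x) \<longlonglongrightarrow> indicator A x * g x"
      proof (cases "x \<in> A")
        case True
        then have "T x \<in> A" using inv by simp
        then obtain n where n: "0 < birkhoff_sum T g n (T x)" by (auto simp: A_def)
        then obtain k where k: "n = Suc k" by (cases n) (auto simp: birkhoff_sum_def)
        \<comment> \<open>Once \<open>m j (T x)\<close> is positive, the maximum with 0 leaves it
          unchanged and \<open>d j x\<close> equals \<open>g x\<close>.\<close>
        have "0 < m j (T x)" if "j \<ge> k" for j
          using n[unfolded k] m_ge[of k "T x"] m_mono[OF that, of "T x"] by linarith
        then have "d j x = g x" if "j \<ge> k" for j
          using True that by (fastforce simp: d_def mS max_def)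
        then have "eventually (\<lambda>j. d j x = g x) sequentially" by (auto simp: eventually_sequentially)
        then show ?thesis using True by (simp add: tendsto_eventually)
      qed (simp add: d_def)
    qed
    show "AE x in \<mu>. norm (d n x) \<le> 2 * B" for n
    proof (rule AE_I2)
      fix x
      have "- B \<le> m n (T x)" using m_mono[of 0 n "T x"] B(2)[of "T x"] by (simp add: m0 abs_le_iff)
      then have "\<bar>m (Suc n) x - m n (T x)\<bar> \<le> 2 * B" using B(2)[of x] unfolding mS by linarith
      then show "norm (d n x) \<le> 2 * B" using B(1) by (cases "x \<in> A") (auto simp: d_def)
    qed
  qed simp
  then have A_int: "0 \<le> (\<integral>x. indicator A x * g x \<partial>\<mu>)" using d_nonneg by (intro LIMSEQ_le_const) auto
  have "T -` A = A" using inv by auto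
  then have "prob A = 0 \<or> prob A = 1" using erg A by (simp add: ergodic_def)
  moreover have "prob A \<noteq> 1"
  proof
    assume "prob A = 1"
    then have "AE x in \<mu>. x \<in> A" using A by (simp add: prob_eq_1 sets)
    then have "(\<integral>x. indicator A x * g x \<partial>\<mu>) = (\<integral>x. g x \<partial>\<mu>)"
      by (intro integral_cong_AE meas g borel_measurable_integrable int) auto
    with A_int neg show False by simp
  qed
  ultimately have "AE x in \<mu>. x \<notin> A" using A by (simp add: prob_eq_0 sets)
  then show ?thesis by eventually_elim (auto simp: A_def not_less)
qed

text \<open>A one-sided ergodic theorem. Boundedness above of the sums of \<open>g - e\<close>
  bounds the limsup of the averages of \<open>g\<close> by \<open>e\<close> almost everywhere, for
  countably many \<open>e\<close> tending to 0. The averages are uniformly bounded, so dominated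
  convergence applies.\<close>

lemma birkhoff_average_pos_part_tendsto:
  assumes erg: "ergodic T \<mu>" and g: "continuous_on UNIV g" and zero: "(\<integral>x. g x \<partial>\<mu>) = 0"
  shows "(\<lambda>n. \<integral>x. max 0 (birkhoff_sum T g n x / real n) \<partial>\<mu>) \<longlonglongrightarrow> 0"
proof -
  have \<mu>: "\<mu> \<in> invariant_measures T" using erg by (simp add: ergodic_def)
  interpret prob_space \<mu> using invariant_measureD(1)[OF \<mu>] .
  obtain B where B: "B \<ge> 0" "\<And>x. \<bar>g x\<bar> \<le> B" by (rule bounded_continuous[OF g], rule that)
  have AE_e: "AE x in \<mu>. \<exists>C. \<forall>n. birkhoff_sum T g n x \<le> real n * e + C" if e: "e > 0" for e
  proof -
    have "AE x in \<mu>. \<exists>C. \<forall>n. birkhoff_sum T (\<lambda>x. g x - e) n x \<le> C"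
    proof (rule birkhoff_sums_bounded_above[OF erg])
      show "(\<integral>x. g x - e \<partial>\<mu>) < 0"
        using e zero integrable_invariant[OF \<mu> g] by (simp add: prob_space)
    qed (intro continuous_intros g)
    then show ?thesis by eventually_elim (simp add: birkhoff_sum_def sum_subtractf algebra_simps)
  qed
  have "AE x in \<mu>. \<forall>k::nat. \<exists>C. \<forall>n. birkhoff_sum T g n x \<le> real n * (1 / real (Suc k)) + C"
    unfolding AE_all_countable by (intro allI AE_e) simp
  then have lim: "AE x in \<mu>. (\<lambda>n. max 0 (birkhoff_sum T g n x / real n)) \<longlonglongrightarrow> 0"
  proof eventually_elim
    case (elim x)
    show ?case
    proof (rule order_tendstoI)
      fix a :: real assume "a > 0"
      then obtain k where k: "1 / real (Suc k) < a" using nat_approx_posE by blast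
      obtain C where C: "\<And>n. birkhoff_sum T g n x \<le> real n * (1 / real (Suc k)) + C"
        using elim by blast
      have "(\<lambda>n. 1 / real (Suc k) + C / real n) \<longlonglongrightarrow> 1 / real (Suc k) + 0"
        by (intro tendsto_intros lim_const_over_n)
      then have "\<forall>\<^sub>F n in sequentially. 1 / real (Suc k) + C / real n < a"
        using k by (intro order_tendstoD) auto
      then show "\<forall>\<^sub>F n in sequentially. max 0 (birkhoff_sum T g n x / real n) < a"
        using eventually_gt_at_top[of 0]
      proof eventually_elim
        case (elim n)
        have "birkhoff_sum T g n x / real n \<le> (real n * (1 / real (Suc k)) + C) / real n"
          using C by (intro divide_right_mono) auto
        also have "\<dots> = 1 / real (Suc k) + C / real n" using elim by (simp add: add_divide_distrib)
        finally show ?case using elim \<open>a > 0\<close> by simp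
      qed
    qed (auto intro!: always_eventually simp: less_max_iff_disj)
  qed
  have "(\<lambda>n. \<integral>x. max 0 (birkhoff_sum T g n x / real n) \<partial>\<mu>) \<longlonglongrightarrow> (\<integral>x. 0 \<partial>\<mu>)"
  proof (rule integral_dominated_convergence[where w="\<lambda>_. B"])
    have [measurable]: "birkhoff_sum T g n \<in> borel_measurable \<mu>" for n
      by (intro borel_measurable_integrable integrable_invariant[OF \<mu>] continuous_birkhoff_sum g)
    show "(\<lambda>x. max 0 (birkhoff_sum T g n x / real n)) \<in> borel_measurable \<mu>" for n
      by measurable
    show "AE x in \<mu>. norm (max 0 (birkhoff_sum T g n x / real n)) \<le> B" for n
    proof (rule AE_I2)
      fix x
      have "birkhoff_sum T g n x \<le> real n * B" using birkhoff_sum_bound[of g B T n x, OF B(2)] by simp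
      then show "norm (max 0 (birkhoff_sum T g n x / real n)) \<le> B"
        using B(1) by (cases "n = 0") (auto simp: field_simps)
    qed
  qed (use lim in auto)
  then show ?thesis by simp
qed

end

subsection \<open>Ergodic measures are exposed\<close>

lemma continuous_suminf:
  fixes r :: "nat \<Rightarrow> 'a::topological_space \<Rightarrow> real"
  assumes "\<And>k. continuous_on UNIV (r k)" "\<And>k x. \<bar>r k x\<bar> \<le> b k" "summable b"
  shows "continuous_on UNIV (\<lambda>x. \<Sum>k. r k x)"
proof (rule uniform_limit_theorem)
  show "uniform_limit UNIV (\<lambda>n x. \<Sum>k<n. r k x) (\<lambda>x. \<Sum>k. r k x) sequentially"
    using assms by (intro Weierstrass_m_test) auto
  show "\<forall>\<^sub>F n in sequentially. continuous_on UNIV (\<lambda>x. \<Sum>k<n. r k x)"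
    by (intro always_eventually allI continuous_intros assms)
qed simp

lemma integral_suminf_sums:
  fixes r :: "nat \<Rightarrow> 'a \<Rightarrow> real"
  assumes "prob_space M" "\<And>k. integrable M (r k)" "\<And>k x. \<bar>r k x\<bar> \<le> b k" "summable b"
  shows "(\<lambda>k. \<integral>x. r k x \<partial>M) sums (\<integral>x. (\<Sum>k. r k x) \<partial>M)"
proof (rule sums_integral)
  interpret prob_space M by fact
  show "AE x in M. summable (\<lambda>k. norm (r k x))"
    using assms by (intro AE_I2 summable_comparison_test'[OF assms(4), of 0]) auto
  have "(\<integral>x. norm (r k x) \<partial>M) \<le> (\<integral>x. b k \<partial>M)" for k
    using assms by (intro integral_mono) auto
  then show "summable (\<lambda>k. \<integral>x. norm (r k x) \<partial>M)"
    by (intro summable_comparison_test'[OF assms(4), of 0]) (auto simp: prob_space)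
qed (use assms in auto)

context compact_system
begin

text \<open>The last condition implies that the integral of \<open>h\<close> is at most that of
  \<open>- g\<close> for every invariant measure. Unlike a pointwise bound
  \<open>h \<le> - g\<close>, it tolerates replacing \<open>g\<close> by its averages along orbits,
  at the price of a larger \<open>C\<close>.\<close>

definition dominated :: "('a \<Rightarrow> real) \<Rightarrow> ('a \<Rightarrow> real) \<Rightarrow> bool" where
  "dominated g h \<longleftrightarrow> continuous_on UNIV h \<and> (\<forall>x. h x \<le> 0) \<and>
     (\<exists>C. \<forall>n x. birkhoff_sum T h n x \<le> C - birkhoff_sum T g n x)"

lemma dominated_integral_le:
  assumes M: "M \<in> invariant_measures T" and g: "continuous_on UNIV g" and h: "dominated g h"
  shows "(\<integral>x. h x \<partial>M) \<le> 0" "(\<integral>x. h x \<partial>M) \<le> - (\<integral>x. g x \<partial>M)"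
proof -
  interpret prob_space M using invariant_measureD(1)[OF M] .
  have hc: "continuous_on UNIV h" "\<And>x. h x \<le> 0" using h by (auto simp: dominated_def)
  show "(\<integral>x. h x \<partial>M) \<le> 0" using hc Bochner_Integration.integral_nonneg[of M "\<lambda>x. - h x"] by simp
  obtain C where C: "\<And>n x. birkhoff_sum T h n x \<le> C - birkhoff_sum T g n x"
    using h by (auto simp: dominated_def)
  have n: "real n * (\<integral>x. h x \<partial>M) \<le> C - real n * (\<integral>x. g x \<partial>M)" for n
  proof -
    have "(\<integral>x. birkhoff_sum T h n x \<partial>M) \<le> (\<integral>x. C - birkhoff_sum T g n x \<partial>M)"
      using C by (intro integral_mono integrable_invariant[OF M] continuous_intros continuous_birkhoff_sum hc g)
    also have "\<dots> = C - (\<integral>x. birkhoff_sum T g n x \<partial>M)"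
      by (subst Bochner_Integration.integral_diff)
        (auto intro!: integrable_invariant[OF M] continuous_birkhoff_sum g simp: prob_space)
    finally show ?thesis by (simp add: integral_birkhoff_sum[OF M] hc g)
  qed
  show "(\<integral>x. h x \<partial>M) \<le> - (\<integral>x. g x \<partial>M)"
  proof (rule LIMSEQ_le_const)
    show "(\<lambda>n. C / real n - (\<integral>x. g x \<partial>M)) \<longlonglongrightarrow> - (\<integral>x. g x \<partial>M)"
      using tendsto_diff[OF lim_const_over_n tendsto_const] by simp
    have "(\<integral>x. h x \<partial>M) \<le> C / real n - (\<integral>x. g x \<partial>M)" if "n \<ge> 1" for n
      using n[of n] that by (simp add: field_simps)
    then show "\<exists>N. \<forall>n\<ge>N. (\<integral>x. h x \<partial>M) \<le> C / real n - (\<integral>x. g x \<partial>M)" by blast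
  qed
qed

text \<open>An average along orbits differs from \<open>g\<close> by the coboundary of a bounded
  function. Concretely, starting \<open>k < n\<close> steps later changes
  \<open>birkhoff_sum T g m\<close> by at most \<open>2 * real n * B\<close>, and averaging over
  \<open>k\<close> gives the claim.\<close>

lemma birkhoff_sum_birkhoff_average:
  assumes B: "\<And>x. \<bar>g x\<bar> \<le> B" and n: "n > 0"
  shows "birkhoff_sum T g m x \<le> birkhoff_sum T (\<lambda>x. birkhoff_sum T g n x / real n) m x + 2 * real n * B"
proof -
  have B0: "0 \<le> B" using B[of undefined] by linarith
  have shift: "birkhoff_sum T g m x - 2 * real n * B \<le> birkhoff_sum T g m ((T ^^ k) x)" if "k < n" for k
  proof -
    have "birkhoff_sum T g k x + birkhoff_sum T g m ((T ^^ k) x)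
        = birkhoff_sum T g m x + birkhoff_sum T g k ((T ^^ m) x)"
      by (simp add: birkhoff_sum_add[symmetric] add.commute)
    moreover have "real k * B \<le> real n * B" using that B0 by (intro mult_right_mono) auto
    ultimately show ?thesis
      using birkhoff_sum_bound[of g B T k x, OF B] birkhoff_sum_bound[of g B T k "(T ^^ m) x", OF B] by linarith
  qed
  have "real n * (birkhoff_sum T g m x - 2 * real n * B) \<le> (\<Sum>k<n. birkhoff_sum T g m ((T ^^ k) x))"
    using sum_bounded_below[of "{..<n}" _ "\<lambda>k. birkhoff_sum T g m ((T ^^ k) x)"] shift by simp
  also have "\<dots> = (\<Sum>j<m. birkhoff_sum T g n ((T ^^ j) x))"
    unfolding birkhoff_sum_def by (subst sum.swap) (simp add: funpow_add[symmetric, THEN fun_cong, unfolded o_apply] add.commute)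
  also have "\<dots> = real n * birkhoff_sum T (\<lambda>x. birkhoff_sum T g n x / real n) m x"
    using n by (simp add: birkhoff_sum_def[of T "\<lambda>x. birkhoff_sum T g n x / real n"] sum_divide_distrib[symmetric])
  finally show ?thesis using n by simp
qed

text \<open>
  The new function is \<open>min (- S\<^sub>n g / n) 0 (S\<^sub>n h / n + \<delta>)\<close> with \<open>\<delta> = - \<integral> h \<partial>\<mu>\<close>: all three terms have
  \<open>\<mu>\<close>-integral zero, so for large \<open>n\<close> it has nearly zero integral, while it remains
  close to \<open>S\<^sub>n h / n\<close>, which is cohomologous to \<open>h\<close>.
\<close>

lemma dominated_improve:
  assumes erg: "ergodic T \<mu>" and g: "continuous_on UNIV g" and zero: "(\<integral>x. g x \<partial>\<mu>) = 0"
    and h: "dominated g h" and \<delta>: "- (\<integral>x. h x \<partial>\<mu>) \<le> \<delta>" and e: "e > 0"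
  shows "\<exists>h'. dominated g h' \<and> - (\<integral>x. h' x \<partial>\<mu>) \<le> e \<and>
    (\<exists>r. continuous_on UNIV r \<and> (\<forall>x. \<bar>r x\<bar> \<le> \<delta> + e) \<and>
      (\<forall>\<nu>\<in>invariant_measures T. (\<integral>x. r x \<partial>\<nu>) = (\<integral>x. h' x \<partial>\<nu>) - (\<integral>x. h x \<partial>\<nu>)))"
proof -
  have \<mu>: "\<mu> \<in> invariant_measures T" using erg by (simp add: ergodic_def)
  interpret prob_space \<mu> using invariant_measureD(1)[OF \<mu>] .
  have hc: "continuous_on UNIV h" "\<And>x. h x \<le> 0" using h by (auto simp: dominated_def)
  obtain C where C: "\<And>n x. birkhoff_sum T h n x \<le> C - birkhoff_sum T g n x"
    using h by (auto simp: dominated_def)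
  define d where "d = - (\<integral>x. h x \<partial>\<mu>)"
  have d: "0 \<le> d" "d \<le> \<delta>"
    using dominated_integral_le(1)[OF \<mu> g h] \<delta> by (simp_all add: d_def)
  \<comment> \<open>The integral of \<open>h\<close> against \<mu> is \<open>- d\<close>, so
    \<open>a\<close> has integral zero and the limit of positive parts applies to it as well as to
    \<open>g\<close>.\<close>
  define a where "a x = - h x - d" for x
  have ac: "continuous_on UNIV a" unfolding a_def by (intro continuous_intros hc)
  have "(\<integral>x. a x \<partial>\<mu>) = 0"
    unfolding a_def using integrable_invariant[OF \<mu> hc(1)] by (simp add: prob_space d_def)
  note limg = birkhoff_average_pos_part_tendsto[OF erg g zero]
    and lima = birkhoff_average_pos_part_tendsto[OF erg ac this]
  have "\<forall>\<^sub>F n in sequentially. (\<integral>x. max 0 (birkhoff_sum T g n x / real n) \<partial>\<mu>)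
      + (\<integral>x. max 0 (birkhoff_sum T a n x / real n) \<partial>\<mu>) < e"
    using tendsto_add[OF limg lima] e by (intro order_tendstoD) auto
  moreover have "\<forall>\<^sub>F n in sequentially. C / real n < e"
    by (rule order_tendstoD(2)[OF lim_const_over_n e])
  ultimately have "\<forall>\<^sub>F n in sequentially. 0 < n \<and> C / real n < e \<and>
      (\<integral>x. max 0 (birkhoff_sum T g n x / real n) \<partial>\<mu>)
      + (\<integral>x. max 0 (birkhoff_sum T a n x / real n) \<partial>\<mu>) < e"
    using eventually_gt_at_top[of 0] by eventually_elim auto
  then obtain n where n: "0 < n" "C / real n < e" "(\<integral>x. max 0 (birkhoff_sum T g n x / real n) \<partial>\<mu>)
      + (\<integral>x. max 0 (birkhoff_sum T a n x / real n) \<partial>\<mu>) < e"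
    by (auto simp: eventually_sequentially)
  define G where "G x = birkhoff_sum T g n x / real n" for x
  define H where "H x = birkhoff_sum T h n x / real n" for x
  have Sa: "birkhoff_sum T a n x / real n = - H x - d" for x
    using n(1) by (simp add: H_def a_def birkhoff_sum_def sum_subtractf sum_negf diff_divide_distrib)
  have cont: "continuous_on UNIV G" "continuous_on UNIV H"
    unfolding G_def H_def using n(1) by (auto intro!: continuous_intros continuous_birkhoff_sum g hc)
  have H0: "H x \<le> 0" for x
    unfolding H_def birkhoff_sum_def using hc(2) by (intro divide_nonpos_nonneg sum_nonpos) auto
  \<comment> \<open>This gives \<open>- G x - H x \<ge> - e\<close>; together with
    \<open>H x \<le> 0\<close> and \<open>0 \<le> d \<le> \<delta>\<close> it places the correction
    \<open>r\<close> between \<open>- e\<close> and \<delta>.\<close>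
  have HG: "H x \<le> e - G x" for x
  proof -
    have "H x \<le> (C - birkhoff_sum T g n x) / real n"
      unfolding H_def using C by (intro divide_right_mono) auto
    then show ?thesis using n(2) by (simp add: G_def diff_divide_distrib)
  qed
  define h' where "h' x = min (min (- G x) 0) (H x + d)" for x
  define r where "r x = h' x - H x" for x
  have h'c: "continuous_on UNIV h'" unfolding h'_def by (intro continuous_intros cont)
  have dom: "dominated g h'"
  proof -
    obtain B where B: "B \<ge> 0" "\<And>x. \<bar>g x\<bar> \<le> B" by (rule bounded_continuous[OF g], rule that)
    have "birkhoff_sum T h' m x \<le> 2 * real n * B - birkhoff_sum T g m x" for m x
    proof -
      have "birkhoff_sum T h' m x \<le> - birkhoff_sum T G m x"
        unfolding birkhoff_sum_def sum_negf[symmetric] by (intro sum_mono) (simp add: h'_def)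
      then show ?thesis
        using birkhoff_sum_birkhoff_average[of g B n m x] B(2) n(1) by (simp add: G_def[abs_def])
    qed
    then show ?thesis using h'c by (auto simp: dominated_def h'_def min_le_iff_disj)
  qed
  have "- (\<integral>x. h' x \<partial>\<mu>) = (\<integral>x. - h' x \<partial>\<mu>)" by simp
  \<comment> \<open>\<open>- h'\<close> is the maximum of \<open>G\<close>, 0 and
    \<open>- H - d\<close>.\<close>
  also have "\<dots> \<le> (\<integral>x. max 0 (G x) + max 0 (- H x - d) \<partial>\<mu>)"
    by (intro integral_mono integrable_invariant[OF \<mu>] continuous_intros cont h'c) (auto simp: h'_def)
  also have "\<dots> = (\<integral>x. max 0 (G x) \<partial>\<mu>) + (\<integral>x. max 0 (- H x - d) \<partial>\<mu>)"
    by (intro Bochner_Integration.integral_add integrable_invariant[OF \<mu>] continuous_intros cont)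
  also have "\<dots> \<le> e" using n(3) by (simp add: Sa G_def)
  finally have small: "- (\<integral>x. h' x \<partial>\<mu>) \<le> e" .
  have "\<bar>r x\<bar> \<le> \<delta> + e" for x
    using H0[of x] HG[of x] d e unfolding r_def h'_def by linarith
  moreover have "continuous_on UNIV r" unfolding r_def by (intro continuous_intros h'c cont)
  \<comment> \<open>\<open>r\<close> is \<open>h' - H\<close> and not \<open>h' - h\<close>; the
    integrals agree because \<open>H\<close> is an orbit average of \<open>h\<close> and \<nu> is
    invariant.\<close>
  moreover have "(\<integral>x. r x \<partial>\<nu>) = (\<integral>x. h' x \<partial>\<nu>) - (\<integral>x. h x \<partial>\<nu>)" if \<nu>: "\<nu> \<in> invariant_measures T" for \<nu>
  proof -
    have "(\<integral>x. r x \<partial>\<nu>) = (\<integral>x. h' x \<partial>\<nu>) - (\<integral>x. H x \<partial>\<nu>)"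
      unfolding r_def by (intro Bochner_Integration.integral_diff integrable_invariant[OF \<nu>] h'c cont)
    then show ?thesis using n(1) by (simp add: H_def integral_birkhoff_sum[OF \<nu> hc(1)])
  qed
  ultimately show ?thesis using dom small by blast
qed

text \<open>Starting from the constant \<open>- B\<close>, repeated improvement halves the bound on
  the defect at \<mu>. The corrections have summable sup norms, so \<open>- B\<close> plus their sum
  is continuous. Its integrals against invariant measures are the limits of those of
  \<open>h n\<close>, and both inequalities pass to the limit.\<close>

lemma ergodic_peak_function:
  fixes g :: "'a \<Rightarrow> real"
  assumes erg: "ergodic T \<mu>" and g: "continuous_on UNIV g"
  obtains f :: "'a \<Rightarrow> real" where "continuous_on UNIV f" "(\<integral>x. f x \<partial>\<mu>) = 0"
    "\<And>\<nu>. \<nu> \<in> invariant_measures T \<Longrightarrow> (\<integral>x. f x \<partial>\<nu>) \<le> 0"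
    "\<And>\<nu>. \<nu> \<in> invariant_measures T \<Longrightarrow> (\<integral>x. f x \<partial>\<nu>) \<le> (\<integral>x. g x \<partial>\<mu>) - (\<integral>x. g x \<partial>\<nu>)"
proof -
  have \<mu>: "\<mu> \<in> invariant_measures T" using erg by (simp add: ergodic_def)
  interpret prob_space \<mu> using invariant_measureD(1)[OF \<mu>] .
  define g0 where "g0 x = g x - (\<integral>x. g x \<partial>\<mu>)" for x
  have g0: "continuous_on UNIV g0" unfolding g0_def by (intro continuous_intros g)
  have zero: "(\<integral>x. g0 x \<partial>\<mu>) = 0"
    unfolding g0_def using integrable_invariant[OF \<mu> g] by (simp add: prob_space)
  obtain B where B: "B \<ge> 0" "\<And>x. \<bar>g0 x\<bar> \<le> B" by (rule bounded_continuous[OF g0], rule that)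
  \<comment> \<open>Adding 1 keeps all tolerances positive even if \<open>B = 0\<close>.\<close>
  define D where "D = B + 1"
  define P where "P k h \<longleftrightarrow> dominated g0 h \<and> - (\<integral>x. h x \<partial>\<mu>) \<le> D * (1/2) ^ k" for k :: nat and h
  define Q where "Q k h h' \<longleftrightarrow> (\<exists>r. continuous_on UNIV r \<and> (\<forall>x. \<bar>r x\<bar> \<le> 2 * D * (1/2) ^ k) \<and>
      (\<forall>\<nu>\<in>invariant_measures T. (\<integral>x. r x \<partial>\<nu>) = (\<integral>x. h' x \<partial>\<nu>) - (\<integral>x. h x \<partial>\<nu>)))"
    for k :: nat and h h' :: "'a \<Rightarrow> real"
  have P0: "P 0 (\<lambda>_. - B)"
  proof -
    have "birkhoff_sum T (\<lambda>_. - B) n x \<le> 0 - birkhoff_sum T g0 n x" for n x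
      using birkhoff_sum_bound[of g0 B T n x, OF B(2)] by (simp add: birkhoff_sum_def[of T "\<lambda>_. - B"])
    then have "dominated g0 (\<lambda>_. - B)" unfolding dominated_def using B(1) by (auto simp del: diff_0)
    then show ?thesis by (simp add: P_def D_def prob_space)
  qed
  have step: "\<exists>h'. P (Suc k) h' \<and> Q k h h'" if Ph: "P k h" for k h
  proof -
    have "D * (1/2) ^ Suc k > 0" using B(1) by (simp add: D_def)
    then obtain h' r where h': "dominated g0 h'" "- (\<integral>x. h' x \<partial>\<mu>) \<le> D * (1/2) ^ Suc k" "continuous_on UNIV r"
        "\<And>x. \<bar>r x\<bar> \<le> D * (1/2) ^ k + D * (1/2) ^ Suc k"
        "\<forall>\<nu>\<in>invariant_measures T. (\<integral>x. r x \<partial>\<nu>) = (\<integral>x. h' x \<partial>\<nu>) - (\<integral>x. h x \<partial>\<nu>)"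
      using dominated_improve[OF erg g0 zero, of h "D * (1/2) ^ k" "D * (1/2) ^ Suc k"] Ph
      unfolding P_def by blast
    have "D * (1/2) ^ k + D * (1/2) ^ Suc k \<le> 2 * D * (1/2) ^ k" using B(1) by (simp add: D_def)
    then have "\<And>x. \<bar>r x\<bar> \<le> 2 * D * (1/2) ^ k" using h'(4) order_trans by blast
    then show ?thesis using h' unfolding P_def Q_def by blast
  qed
  obtain h where h0: "h 0 = (\<lambda>_. - B)" and hP: "\<And>k. P k (h k)" and hQ: "\<And>k. Q k (h k) (h (Suc k))"
  proof -
    have "\<exists>h. h 0 = (\<lambda>_. - B) \<and> (\<forall>k. P k (h k) \<and> Q k (h k) (h (Suc k)))"
    proof -
      \<comment> \<open>Dependent choice does not fix the first element, so the starting function is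
        built into the predicate.\<close>
      define P' where "P' k h \<longleftrightarrow> P k h \<and> (k = 0 \<longrightarrow> h = (\<lambda>_. - B))" for k h
      have "\<exists>h. \<forall>k. P' k (h k) \<and> Q k (h k) (h (Suc k))"
        by (rule dependent_nat_choice) (use P0 step in \<open>auto simp: P'_def\<close>)
      then show ?thesis unfolding P'_def by metis
    qed
    then show ?thesis using that by blast
  qed
  obtain r where r: "\<And>k. continuous_on UNIV (r k)" "\<And>k x. \<bar>r k x\<bar> \<le> 2 * D * (1/2) ^ k"
      "\<And>k \<nu>. \<nu> \<in> invariant_measures T \<Longrightarrow> (\<integral>x. r k x \<partial>\<nu>) = (\<integral>x. h (Suc k) x \<partial>\<nu>) - (\<integral>x. h k x \<partial>\<nu>)"
    using hQ unfolding Q_def by metis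
  have sm: "summable (\<lambda>k. 2 * D * (1/2) ^ k)" by (intro summable_mult summable_geometric) simp
  define s where "s x = (\<Sum>k. r k x)" for x
  define f where "f x = s x - B" for x
  have sc: "continuous_on UNIV s" unfolding s_def by (rule continuous_suminf[OF r(1,2) sm])
  have lim: "(\<lambda>n. \<integral>x. h n x \<partial>\<nu>) \<longlonglongrightarrow> (\<integral>x. f x \<partial>\<nu>)" if \<nu>: "\<nu> \<in> invariant_measures T" for \<nu>
  proof -
    interpret N: prob_space \<nu> using invariant_measureD(1)[OF \<nu>] .
    have "(\<lambda>k. \<integral>x. r k x \<partial>\<nu>) sums (\<integral>x. s x \<partial>\<nu>)"
      unfolding s_def by (intro integral_suminf_sums[OF N.prob_space_axioms _ r(2) sm] integrable_invariant[OF \<nu>] r(1))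
    then have "(\<lambda>n. (\<integral>x. h n x \<partial>\<nu>) - (\<integral>x. h 0 x \<partial>\<nu>)) \<longlonglongrightarrow> (\<integral>x. s x \<partial>\<nu>)"
      by (simp add: sums_def r(3)[OF \<nu>] sum_lessThan_telescope[of "\<lambda>n. \<integral>x. h n x \<partial>\<nu>"])
    from tendsto_diff[OF this tendsto_const[of B]] show ?thesis
      using integrable_invariant[OF \<nu> sc] by (simp add: h0 f_def N.prob_space)
  qed
  have dom: "dominated g0 (h k)" for k using hP[of k] by (simp add: P_def)
  show ?thesis
  proof
    show "continuous_on UNIV f" unfolding f_def by (intro continuous_intros sc)
    show le0: "(\<integral>x. f x \<partial>\<nu>) \<le> 0" if \<nu>: "\<nu> \<in> invariant_measures T" for \<nu>
      using dominated_integral_le(1)[OF \<nu> g0 dom] by (intro LIMSEQ_le_const2[OF lim[OF \<nu>]]) auto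
    show "(\<integral>x. f x \<partial>\<nu>) \<le> (\<integral>x. g x \<partial>\<mu>) - (\<integral>x. g x \<partial>\<nu>)" if \<nu>: "\<nu> \<in> invariant_measures T" for \<nu>
    proof -
      interpret N: prob_space \<nu> using invariant_measureD(1)[OF \<nu>] .
      have "(\<integral>x. f x \<partial>\<nu>) \<le> - (\<integral>x. g0 x \<partial>\<nu>)"
        using dominated_integral_le(2)[OF \<nu> g0 dom] by (intro LIMSEQ_le_const2[OF lim[OF \<nu>]]) auto
      then show ?thesis using integrable_invariant[OF \<nu> g] by (simp add: g0_def N.prob_space)
    qed
    have "0 \<le> (\<integral>x. f x \<partial>\<mu>)"
    proof (rule LIMSEQ_le[OF _ lim[OF \<mu>]])
      have "(\<lambda>k. - (D * (1/2) ^ k)) \<longlonglongrightarrow> - (D * 0)" by (intro tendsto_intros LIMSEQ_power_zero) simp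
      then show "(\<lambda>k. - (D * (1/2) ^ k)) \<longlonglongrightarrow> 0" by simp
      show "\<exists>N. \<forall>n\<ge>N. - (D * (1/2) ^ n) \<le> (\<integral>x. h n x \<partial>\<mu>)" using hP unfolding P_def by (metis minus_le_iff)
    qed
    then show "(\<integral>x. f x \<partial>\<mu>) = 0" using le0[OF \<mu>] by simp
  qed
qed

text \<open>The exposing function is a weighted sum of peak functions for a determining family.
  Every term has integral 0 against \<mu> and at most 0 against an invariant \<nu>. If
  \<open>\<nu> \<noteq> \<mu>\<close>, some \<open>g i\<close> has a larger integral against \<nu>
  than against \<mu>, and the term of index \<open>i\<close> is strictly negative.\<close>

lemma ergodic_exposed:
  assumes erg: "ergodic T \<mu>"
  obtains \<psi> :: "'a \<Rightarrow> real" where "continuous_on UNIV \<psi>"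
    "\<And>\<nu>. \<nu> \<in> invariant_measures T \<Longrightarrow> \<nu> \<noteq> \<mu> \<Longrightarrow> (\<integral>x. \<psi> x \<partial>\<nu>) < (\<integral>x. \<psi> x \<partial>\<mu>)"
proof -
  have \<mu>: "\<mu> \<in> invariant_measures T" using erg by (simp add: ergodic_def)
  obtain g :: "nat \<Rightarrow> 'a \<Rightarrow> real" where g: "\<And>i. continuous_on UNIV (g i)"
    "\<And>M N. prob_space M \<Longrightarrow> sets M = sets borel \<Longrightarrow> prob_space N \<Longrightarrow> sets N = sets borel \<Longrightarrow>
       (\<And>i. (\<integral>x. g i x \<partial>M) \<le> (\<integral>x. g i x \<partial>N)) \<Longrightarrow> M = N"
    by (rule countable_determining_family[OF compact_space]) (erule that, blast)
  have "\<exists>f b. continuous_on UNIV f \<and> (\<forall>x. \<bar>f x\<bar> \<le> b) \<and> b > 0 \<and> (\<integral>x. f x \<partial>\<mu>) = 0 \<and>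
    (\<forall>\<nu>\<in>invariant_measures T. (\<integral>x. f x \<partial>\<nu>) \<le> 0 \<and>
      (\<integral>x. f x \<partial>\<nu>) \<le> (\<integral>x. g i x \<partial>\<mu>) - (\<integral>x. g i x \<partial>\<nu>))" for i
  proof -
    obtain f :: "'a \<Rightarrow> real" where f: "continuous_on UNIV f" "(\<integral>x. f x \<partial>\<mu>) = 0"
      "\<And>\<nu>. \<nu> \<in> invariant_measures T \<Longrightarrow> (\<integral>x. f x \<partial>\<nu>) \<le> 0"
      "\<And>\<nu>. \<nu> \<in> invariant_measures T \<Longrightarrow> (\<integral>x. f x \<partial>\<nu>) \<le> (\<integral>x. g i x \<partial>\<mu>) - (\<integral>x. g i x \<partial>\<nu>)"
      by (rule ergodic_peak_function[OF erg g(1)[of i]], rule that)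
    obtain B where B: "B \<ge> 0" "\<And>x. \<bar>f x\<bar> \<le> B" by (rule bounded_continuous[OF f(1)], rule that)
    have "\<bar>f x\<bar> \<le> B + 1" "B + 1 > 0" for x using B(1) B(2)[of x] by linarith+
    then show ?thesis using f by blast
  qed
  then obtain f b where f: "\<And>i. continuous_on UNIV (f i)" "\<And>i x. \<bar>f i x\<bar> \<le> b i" "\<And>i. b i > 0"
      "\<And>i. (\<integral>x. f i x \<partial>\<mu>) = 0" "\<And>i \<nu>. \<nu> \<in> invariant_measures T \<Longrightarrow> (\<integral>x. f i x \<partial>\<nu>) \<le> 0"
      "\<And>i \<nu>. \<nu> \<in> invariant_measures T \<Longrightarrow> (\<integral>x. f i x \<partial>\<nu>) \<le> (\<integral>x. g i x \<partial>\<mu>) - (\<integral>x. g i x \<partial>\<nu>)"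
    by metis
  define u where "u i x = (1/2) ^ i / b i * f i x" for i x
  have u_bd: "\<bar>u i x\<bar> \<le> (1/2) ^ i" for i x
    using f(2)[of i x] f(3)[of i] by (simp add: u_def abs_mult field_simps)
  have sm: "summable (\<lambda>i. (1/2) ^ i :: real)" by (intro summable_geometric) simp
  have u_cont: "continuous_on UNIV (u i)" for i unfolding u_def by (intro continuous_intros f(1))
  define \<psi> where "\<psi> x = (\<Sum>i. u i x)" for x
  have sums: "(\<lambda>i. (1/2) ^ i / b i * (\<integral>x. f i x \<partial>\<nu>)) sums (\<integral>x. \<psi> x \<partial>\<nu>)"
    if \<nu>: "\<nu> \<in> invariant_measures T" for \<nu>
  proof -
    have "(\<lambda>i. \<integral>x. u i x \<partial>\<nu>) sums (\<integral>x. \<psi> x \<partial>\<nu>)" unfolding \<psi>_def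
      by (intro integral_suminf_sums[OF invariant_measureD(1)[OF \<nu>] _ u_bd sm] integrable_invariant[OF \<nu>] u_cont)
    then show ?thesis by (simp add: u_def)
  qed
  show ?thesis
  proof
    show "continuous_on UNIV \<psi>" unfolding \<psi>_def by (rule continuous_suminf[OF u_cont u_bd sm])
    fix \<nu> assume \<nu>: "\<nu> \<in> invariant_measures T" "\<nu> \<noteq> \<mu>"
    have "\<exists>i. (\<integral>x. g i x \<partial>\<mu>) < (\<integral>x. g i x \<partial>\<nu>)"
      using g(2)[of \<nu> \<mu>] invariant_measureD(1,3)[OF \<nu>(1)] invariant_measureD(1,3)[OF \<mu>] \<nu>(2)
      by (meson not_le)
    then obtain i where i: "(\<integral>x. g i x \<partial>\<mu>) < (\<integral>x. g i x \<partial>\<nu>)" by blast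
    have w: "0 < (1/2) ^ i / b i" for i using f(3)[of i] by simp
    have neg: "(\<lambda>i. - ((1/2) ^ i / b i * (\<integral>x. f i x \<partial>\<nu>))) sums (- (\<integral>x. \<psi> x \<partial>\<nu>))"
      by (intro sums_minus sums \<nu>)
    have "0 < (\<Sum>i. - ((1/2) ^ i / b i * (\<integral>x. f i x \<partial>\<nu>)))"
    proof (rule suminf_pos2[OF sums_summable[OF neg]])
      show "0 \<le> - ((1/2) ^ i / b i * (\<integral>x. f i x \<partial>\<nu>))" for i
        using mult_nonneg_nonpos[OF less_imp_le[OF w[of i]] f(5)[OF \<nu>(1), of i]] by linarith
      have "(\<integral>x. f i x \<partial>\<nu>) < 0" using f(6)[OF \<nu>(1), of i] i by linarith
      from mult_pos_neg[OF w this] show "0 < - ((1/2) ^ i / b i * (\<integral>x. f i x \<partial>\<nu>))" by simp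
    qed
    then have "0 < - (\<integral>x. \<psi> x \<partial>\<nu>)" using sums_unique[OF neg] by simp
    moreover have "(\<integral>x. \<psi> x \<partial>\<mu>) = 0" using sums[OF \<mu>] by (simp add: f(4) sums_iff)
    ultimately show "(\<integral>x. \<psi> x \<partial>\<nu>) < (\<integral>x. \<psi> x \<partial>\<mu>)" by simp
  qed
qed

end

subsection \<open>Entropy is bounded by pressure\<close>

text \<open>Fekete's lemma, by division with remainder. Through it the \<open>lim\<close> in
  \<open>measure_entropy\<close> denotes an actual limit.\<close>

lemma subadditive_quotient_convergent:
  fixes a :: "nat \<Rightarrow> real"
  assumes sub: "\<And>m n. a (m + n) \<le> a m + a n" and nonneg: "\<And>n. 0 \<le> a n"
  shows "convergent (\<lambda>n. a n / real n)"
proof -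
  define L where "L = (INF n\<in>{1..}. a n / real n)"
  have bdd: "bdd_below ((\<lambda>n. a n / real n) ` {1..})" by (rule bdd_belowI2[of _ 0]) (simp add: nonneg)
  have "(\<lambda>n. a n / real n) \<longlonglongrightarrow> L"
  proof (rule order_tendstoI)
    fix c assume "c < L"
    moreover have "L \<le> a n / real n" if "n \<ge> 1" for n
      unfolding L_def using that by (intro cINF_lower bdd) auto
    ultimately show "\<forall>\<^sub>F n in sequentially. c < a n / real n"
      by (intro eventually_sequentiallyI[of 1]) (auto intro: less_le_trans)
  next
    fix c assume "L < c"
    then have "\<exists>m\<in>{1..}. a m / real m < c"
      unfolding L_def by (subst (asm) cINF_less_iff[OF _ bdd]) auto
    then obtain m where m: "m \<ge> 1" "a m / real m < c" by auto
    \<comment> \<open>Bounds every remainder term \<open>a r\<close> with \<open>r < m\<close>,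
      since all terms are nonnegative.\<close>
    define K where "K = (\<Sum>r<m. a r)"
    have mult: "a (q * m + r) \<le> real q * a m + a r" for q r
    proof (induction q)
      case (Suc q)
      then show ?case using sub[of m "q * m + r"] by (simp add: algebra_simps)
    qed simp
    have le: "a n / real n \<le> a m / real m + K / real n" if "n \<ge> 1" for n
    proof -
      have "a (n mod m) \<le> K" unfolding K_def
        using m nonneg by (intro member_le_sum) auto
      then have "a n \<le> real (n div m) * a m + K" using mult[of "n div m" "n mod m"] by simp
      also have "real (n div m) * a m = (real (n div m) * real m) * (a m / real m)" using m by simp
      also have "\<dots> \<le> real n * (a m / real m)"
        unfolding of_nat_mult[symmetric] using nonneg by (intro mult_right_mono) (simp_all del: of_nat_mult)
      finally have "a n / real n \<le> (real n * (a m / real m) + K) / real n"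
        by (intro divide_right_mono) auto
      then show ?thesis using that by (simp add: add_divide_distrib)
    qed
    have "(\<lambda>n. a m / real m + K / real n) \<longlonglongrightarrow> a m / real m + 0"
      by (intro tendsto_intros lim_const_over_n)
    then have "\<forall>\<^sub>F n in sequentially. a m / real m + K / real n < c"
      using m by (intro order_tendstoD) auto
    then show "\<forall>\<^sub>F n in sequentially. a n / real n < c"
      using eventually_ge_at_top[of 1] by eventually_elim (use le in \<open>auto intro: le_less_trans\<close>)
  qed
  then show ?thesis by (auto simp: convergent_def)
qed

text \<open>The bound \<open>ln t \<le> t - 1\<close>, with \<open>t\<close> the ratio of the Gibbs
  weight \<open>exp (a y) / Z\<close> to \<open>p y\<close>, summed with weights \<open>p y\<close>.
  Equality would hold for the Gibbs weights themselves.\<close>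

lemma gibbs_inequality:
  fixes p a :: "'b \<Rightarrow> real"
  assumes E: "finite E" "E \<noteq> {}" and p: "\<And>y. y \<in> E \<Longrightarrow> 0 \<le> p y" "(\<Sum>y\<in>E. p y) = 1"
  shows "- (\<Sum>y\<in>E. p y * ln (p y)) + (\<Sum>y\<in>E. p y * a y) \<le> ln (\<Sum>y\<in>E. exp (a y))"
proof -
  define Z where "Z = (\<Sum>y\<in>E. exp (a y))"
  have Z: "Z > 0" unfolding Z_def using E by (intro sum_pos) auto
  have term_le: "p y * (a y - ln (p y) - ln Z) \<le> exp (a y) / Z - p y" if y: "y \<in> E" for y
  proof (cases "p y = 0")
    case True
    then show ?thesis using Z by simp
  next
    case False
    then have pos: "p y > 0" using p(1)[OF y] by simp
    have "a y - ln (p y) - ln Z = ln (exp (a y) / (Z * p y))"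
      using Z pos by (simp add: ln_div ln_mult)
    also have "\<dots> \<le> exp (a y) / (Z * p y) - 1" using Z pos by (intro ln_le_minus_one) simp
    finally have "p y * (a y - ln (p y) - ln Z) \<le> p y * (exp (a y) / (Z * p y) - 1)"
      using pos by simp
    also have "\<dots> = exp (a y) / Z - p y" using pos Z by (simp add: field_simps)
    finally show ?thesis .
  qed
  have "(\<Sum>y\<in>E. p y * a y) - (\<Sum>y\<in>E. p y * ln (p y)) - (\<Sum>y\<in>E. p y) * ln Z
      = (\<Sum>y\<in>E. p y * (a y - ln (p y) - ln Z))"
    by (simp add: right_diff_distrib sum_subtractf sum_distrib_right)
  also have "\<dots> \<le> (\<Sum>y\<in>E. exp (a y) / Z - p y)"
    by (intro sum_mono term_le)
  also have "\<dots> = 0" using Z p(2) by (simp add: sum_subtractf sum_divide_distrib[symmetric] Z_def[symmetric])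
  finally show ?thesis using p(2) by (simp add: Z_def)
qed

text \<open>Makes the entropy contribution of a small atom tend to 0 with its mass; it is
  \<open>ln u \<le> u - 1\<close> at \<open>u = 1 / sqrt t\<close>.\<close>

lemma entropy_term_le_sqrt:
  fixes t :: real
  assumes "0 \<le> t"
  shows "- (t * ln t) \<le> 2 * sqrt t"
proof (cases "t = 0")
  case False
  then have t: "t > 0" using assms by simp
  have "- ln t / 2 = ln (1 / sqrt t)" using t by (simp add: ln_div ln_sqrt)
  also have "\<dots> \<le> 1 / sqrt t" using t ln_le_minus_one[of "1 / sqrt t"] by simp
  finally have "t * (- ln t) \<le> t * (2 / sqrt t)" using t by (intro mult_left_mono) auto
  also have "\<dots> = 2 * sqrt t" using t by (simp add: real_div_sqrt field_simps)
  finally show ?thesis by simp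
qed simp

text \<open>The companion estimate for an atom of nearly full mass.\<close>

lemma entropy_term_le_compl:
  fixes u :: real
  assumes "0 \<le> u"
  shows "- (u * ln u) \<le> 1 - u"
proof (cases "u = 0")
  case False
  then have u: "u > 0" using assms by simp
  have "- ln u = ln (1 / u)" using u by (simp add: ln_div)
  also have "\<dots> \<le> 1 / u - 1" using u by (intro ln_le_minus_one) simp
  finally have "u * (- ln u) \<le> u * (1 / u - 1)" using u by (intro mult_left_mono) auto
  also have "\<dots> = 1 - u" using u by (simp add: field_simps)
  finally show ?thesis by simp
qed simp

text \<open>Each point takes the first admissible element in an enumeration of \<open>E\<close>;
  choosing the least index is measurable.\<close>

lemma finite_measurable_selection:
  assumes E: "finite E" and W: "\<And>y. y \<in> E \<Longrightarrow> W y \<in> sets M" and cover: "\<And>x. x \<in> space M \<Longrightarrow> \<exists>y\<in>E. x \<in> W y"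
  obtains \<pi> where "simple_function M \<pi>" "\<And>x. x \<in> space M \<Longrightarrow> \<pi> x \<in> E \<and> x \<in> W (\<pi> x)"
proof -
  obtain h where h: "bij_betw h {..<card E} E"
    using ex_bij_betw_nat_finite[OF E] by (auto simp: atLeast0LessThan)
  define P where "P i x \<longleftrightarrow> i < card E \<and> x \<in> W (h i)" for i x
  define \<pi> where "\<pi> x = h (LEAST i. P i x)" for x
  have P: "P (LEAST i. P i x) x" if x: "x \<in> space M" for x
  proof -
    obtain y where "y \<in> E" "x \<in> W y" using cover[OF x] by blast
    moreover then obtain i where "i < card E" "h i = y"
      using h unfolding bij_betw_def by (metis imageE lessThan_iff)
    ultimately have "P i x" by (simp add: P_def)
    then show ?thesis by (rule LeastI)
  qed
  have mem: "\<pi> x \<in> E \<and> x \<in> W (\<pi> x)" if "x \<in> space M" for x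
    using P[OF that] h by (auto simp: \<pi>_def P_def bij_betw_def)
  have "Measurable.pred M (P i)" for i
  proof (cases "i < card E")
    case True
    then have "W (h i) \<in> sets M" using W h by (auto simp: bij_betw_def)
    then show ?thesis using True by (simp add: P_def[abs_def])
  qed (simp add: P_def[abs_def])
  then have "(\<lambda>x. LEAST i. P i x) \<in> measurable M (count_space UNIV)" by (rule measurable_Least)
  then have "\<pi> \<in> measurable M (count_space UNIV)"
    unfolding \<pi>_def by (rule measurable_compose) simp
  moreover have "finite (\<pi> ` space M)" using mem by (intro finite_subset[OF _ E]) auto
  ultimately have "simple_function M \<pi>"
    by (auto simp: simple_function_def intro: measurable_sets)
  then show ?thesis using mem that by blast
qed

section \<open>Itineraries and iterated joins\<close>

definition itinerary :: "('a \<Rightarrow> 'a) \<Rightarrow> ('a \<Rightarrow> 'b) \<Rightarrow> nat \<Rightarrow> 'a \<Rightarrow> 'b list" where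
  "itinerary T \<alpha> n x = map (\<lambda>k. \<alpha> ((T ^^ k) x)) [0..<n]"

lemma itinerary_Suc: "itinerary T \<alpha> (Suc n) x = itinerary T \<alpha> n x @ [\<alpha> ((T ^^ n) x)]"
  by (simp add: itinerary_def)

lemma itinerary_add: "itinerary T \<alpha> (m + n) x = itinerary T \<alpha> m x @ itinerary T \<alpha> n ((T ^^ m) x)"
  by (induction n) (simp_all add: itinerary_def funpow_add[symmetric, THEN fun_cong, unfolded o_apply] add.commute)

lemma itinerary_eq_iff:
  "itinerary T \<alpha> n x = itinerary T \<alpha> n y \<longleftrightarrow> (\<forall>k<n. \<alpha> ((T ^^ k) x) = \<alpha> ((T ^^ k) y))"
  by (auto simp: itinerary_def)

definition cell :: "'a set set \<Rightarrow> 'a \<Rightarrow> 'a set" where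
  "cell \<xi> x = (THE A. A \<in> \<xi> \<and> x \<in> A)"

lemma cell:
  assumes "partition_on UNIV \<xi>"
  shows "cell \<xi> x \<in> \<xi>" "x \<in> cell \<xi> x" "A \<in> \<xi> \<Longrightarrow> cell \<xi> x = A \<longleftrightarrow> x \<in> A"
proof -
  have ex1: "\<exists>!A. A \<in> \<xi> \<and> x \<in> A"
    using assms unfolding partition_on_def disjoint_def by (metis IntI UNIV_I UnionE empty_iff)
  from theI'[OF ex1] show 1: "cell \<xi> x \<in> \<xi>" "x \<in> cell \<xi> x" by (simp_all add: cell_def)
  show "A \<in> \<xi> \<Longrightarrow> cell \<xi> x = A \<longleftrightarrow> x \<in> A" using ex1 1 by blast
qed

lemma cell_vimage:
  assumes "partition_on UNIV \<xi>" "A \<in> \<xi>"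
  shows "cell \<xi> -` {A} = A"
  using cell(3)[OF assms] by auto

text \<open>A choice \<open>f\<close> of cells with nonempty intersection is read off from any point
  in it, so the members of the join are the fibres of the itinerary. The entropy of the join thus
  becomes that of one finite-valued function.\<close>

lemma iterated_join_eq:
  assumes "partition_on UNIV \<xi>"
  shows "iterated_join T \<xi> n = (\<lambda>v. itinerary T (cell \<xi>) n -` {v}) ` range (itinerary T (cell \<xi>) n)"
proof -
  have eq: "(\<Inter>k<n. (T ^^ k) -` f k) = itinerary T (cell \<xi>) n -` {itinerary T (cell \<xi>) n x}"
    if f: "f \<in> {..<n} \<rightarrow>\<^sub>E \<xi>" and x: "x \<in> (\<Inter>k<n. (T ^^ k) -` f k)" for f x
  proof -
    have iff: "(T ^^ k) y \<in> f k \<longleftrightarrow> cell \<xi> ((T ^^ k) y) = cell \<xi> ((T ^^ k) x)" if "k < n" for k y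
    proof -
      have "f k \<in> \<xi>" "(T ^^ k) x \<in> f k" using f x that by auto
      then show ?thesis using cell(3)[OF assms] by metis
    qed
    then show ?thesis by (auto simp: itinerary_eq_iff iff)
  qed
  show ?thesis
  proof (rule set_eqI, rule iffI)
    fix S assume "S \<in> iterated_join T \<xi> n"
    then obtain f where f: "f \<in> {..<n} \<rightarrow>\<^sub>E \<xi>" "S = (\<Inter>k<n. (T ^^ k) -` f k)" "S \<noteq> {}"
      by (auto simp: iterated_join_def)
    then obtain x where "x \<in> S" by blast
    then show "S \<in> (\<lambda>v. itinerary T (cell \<xi>) n -` {v}) ` range (itinerary T (cell \<xi>) n)"
      using eq[OF f(1), of x] f(2) by blast
  next
    fix S assume "S \<in> (\<lambda>v. itinerary T (cell \<xi>) n -` {v}) ` range (itinerary T (cell \<xi>) n)"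
    then obtain x where S: "S = itinerary T (cell \<xi>) n -` {itinerary T (cell \<xi>) n x}" by blast
    define f where "f = (\<lambda>k\<in>{..<n}. cell \<xi> ((T ^^ k) x))"
    have f: "f \<in> {..<n} \<rightarrow>\<^sub>E \<xi>" using cell(1)[OF assms] by (auto simp: f_def)
    have x: "x \<in> (\<Inter>k<n. (T ^^ k) -` f k)" using cell(2)[OF assms] by (auto simp: f_def)
    have "S = (\<Inter>k<n. (T ^^ k) -` f k)" using eq[OF f x] S by simp
    moreover have "S \<noteq> {}" using S by blast
    ultimately show "S \<in> iterated_join T \<xi> n" using f by (auto simp: iterated_join_def)
  qed
qed

lemma compact_closed_separated:
  fixes S F :: "'a::metric_space set"
  assumes "compact S" "closed F" "S \<inter> F = {}"
  shows "\<exists>d>0. \<forall>x\<in>S. \<forall>y\<in>F. d \<le> dist x y"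
proof (cases "S = {} \<or> F = {}")
  case True
  then show ?thesis by (intro exI[of _ 1]) auto
next
  case False
  have "continuous_on S (\<lambda>x. infdist x F)" by (intro continuous_intros)
  then obtain x where x: "x \<in> S" "\<And>y. y \<in> S \<Longrightarrow> infdist x F \<le> infdist y F"
    using continuous_attains_inf[OF assms(1)] False by blast
  have "infdist x F > 0" using infdist_pos_not_in_closed[OF assms(2)] x(1) assms(3) False by blast
  then show ?thesis
    using x(2) infdist_le order_trans by (intro exI[of _ "infdist x F"]) blast
qed

section \<open>Entropy of finite-valued functions under an invariant measure\<close>

locale invariant_system = compact_system T for T :: "'a::metric_space \<Rightarrow> 'a" +
  fixes M :: "'a measure"
  assumes invariant: "M \<in> invariant_measures T"

text \<open>Base \<open>exp 1\<close> turns \<open>log\<close> into \<open>ln\<close>, as in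
  \<open>partition_entropy\<close>.\<close>

sublocale invariant_system \<subseteq> information_space M "exp 1"
  using invariant_measureD(1)[OF invariant]
  by (intro information_space.intro information_space_axioms.intro) auto

context invariant_system
begin

abbreviation entropy_of :: "('a \<Rightarrow> 'b) \<Rightarrow> real" ("\<H>'(_')") where
  "\<H>(X) \<equiv> entropy (exp 1) (count_space (X ` space M)) X"

lemmas sets_M = invariant_measureD(3)[OF invariant]
  and space_M = invariant_measureD(4)[OF invariant]

lemma measurable_iterate: "(T ^^ k) \<in> measurable M M"
  using borel_measurable_continuous_onI[OF continuous_iterate[of k]]
  by (simp cong: measurable_cong_sets add: sets_M)

lemma prob_vimage_iterate:
  assumes "A \<in> sets borel"
  shows "prob ((T ^^ k) -` A) = prob A"
  using assms
proof (induction k arbitrary: A)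
  case (Suc k)
  have T: "T \<in> measurable M borel" using measurable_T by (simp cong: measurable_cong_sets add: sets_M)
  have B: "(T ^^ k) -` A \<in> sets borel"
    using measurable_sets[OF measurable_iterate, of A k] Suc.prems by (simp add: sets_M space_M)
  have "prob (T -` ((T ^^ k) -` A)) = measure (distr M borel T) ((T ^^ k) -` A)"
    using measure_distr[OF T B] by (simp add: space_M)
  also have "\<dots> = prob A" using Suc by (simp add: invariant_measureD(5)[OF invariant])
  also have "T -` ((T ^^ k) -` A) = (T ^^ Suc k) -` A" by (auto simp: funpow_swap1)
  finally show ?case .
qed simp

text \<open>Values in \<open>V\<close> outside the range have empty fibres and contribute 0, so any
  finite superset of the range may index the sum.\<close>

lemma entropy_eq:
  assumes X: "simple_function M X" and V: "finite V" "range X \<subseteq> V"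
  shows "\<H>(X) = - (\<Sum>v\<in>V. prob (X -` {v}) * ln (prob (X -` {v})))"
proof -
  have "\<H>(X) = - (\<Sum>v\<in>range X. prob (X -` {v}) * ln (prob (X -` {v})))"
    using entropy_simple_distributed[OF simple_distributedI[OF X measure_nonneg refl]]
    by (simp add: space_M log_def)
  also have "(\<Sum>v\<in>range X. prob (X -` {v}) * ln (prob (X -` {v}))) = (\<Sum>v\<in>V. prob (X -` {v}) * ln (prob (X -` {v})))"
  proof (rule sum.mono_neutral_left[OF V])
    show "\<forall>v\<in>V - range X. prob (X -` {v}) * ln (prob (X -` {v})) = 0"
    proof
      fix v assume "v \<in> V - range X"
      then have "X -` {v} = {}" by auto
      then show "prob (X -` {v}) * ln (prob (X -` {v})) = 0" by simp
    qed
  qed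
  finally show ?thesis .
qed

lemma finite_range_simple: "simple_function M X \<Longrightarrow> finite (range X)"
  by (simp add: simple_function_def space_M)

lemma vimage_simple: "simple_function M X \<Longrightarrow> X -` {v} \<in> sets borel"
  using measurable_sets[OF measurable_simple_function, of M X "{v}"] by (simp add: space_M sets_M)

lemma sum_prob_fibres:
  assumes X: "simple_function M X" and V: "finite V" "range X \<subseteq> V"
  shows "(\<Sum>v\<in>V. prob (X -` {v})) = 1"
proof -
  have "(\<Sum>v\<in>V. prob (X -` {v})) = prob (\<Union>v\<in>V. X -` {v})"
    using vimage_simple[OF X] V(1)
    by (intro finite_measure_finite_Union[symmetric]) (auto simp: disjoint_family_on_def sets_M)
  also have "(\<Union>v\<in>V. X -` {v}) = space M" using V(2) by (auto simp: space_M)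
  finally show ?thesis by (simp add: prob_space)
qed

lemma entropy_nonneg:
  assumes X: "simple_function M X"
  shows "0 \<le> \<H>(X)"
proof -
  have "prob (X -` {v}) * ln (prob (X -` {v})) \<le> 0" for v
  proof (cases "prob (X -` {v}) = 0")
    case False
    then have "0 < prob (X -` {v})" by (simp add: less_le)
    then show ?thesis using prob_le_1[of "X -` {v}"] by (intro mult_nonneg_nonpos) auto
  qed simp
  then show ?thesis
    by (subst entropy_eq[OF X finite_range_simple[OF X] order_refl]) (simp add: sum_nonpos)
qed

text \<open>\<open>Y\<close> factors through \<open>X\<close>, via a chosen preimage of each value,
  and processing data cannot raise entropy.\<close>

lemma entropy_determined:
  assumes X: "simple_function M X" and det: "\<And>x y. X x = X y \<Longrightarrow> Y x = Y y"
  shows "\<H>(Y) \<le> \<H>(X)"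
proof -
  have "Y = (\<lambda>v. Y (SOME x. X x = v)) \<circ> X"
  proof
    fix x
    have "X (SOME y. X y = X x) = X x" by (rule someI) simp
    from det[OF this] show "Y x = ((\<lambda>v. Y (SOME x. X x = v)) \<circ> X) x" by simp
  qed
  then show ?thesis using entropy_data_processing[OF X] by metis
qed

lemma entropy_Pair_le:
  assumes X: "simple_function M X" and Y: "simple_function M Y"
  shows "\<H>(\<lambda>x. (X x, Y x)) \<le> \<H>(X) + \<H>(Y)"
  using entropy_chain_rule[OF X Y] conditional_entropy_less_eq_entropy[OF Y X] by simp

lemma simple_function_iterate:
  assumes X: "simple_function M X"
  shows "simple_function M (\<lambda>x. X ((T ^^ k) x))"
proof -
  have "(\<lambda>x. X ((T ^^ k) x)) \<in> measurable M (count_space UNIV)"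
    by (rule measurable_compose[OF measurable_iterate measurable_simple_function[OF X]])
  moreover have "finite (range (\<lambda>x. X ((T ^^ k) x)))"
    by (rule finite_subset[OF _ finite_range_simple[OF X]]) auto
  ultimately show ?thesis by (simp add: simple_function_eq_measurable space_M)
qed

lemma entropy_iterate:
  assumes X: "simple_function M X"
  shows "\<H>(\<lambda>x. X ((T ^^ k) x)) = \<H>(X)"
proof -
  have "(\<lambda>x. X ((T ^^ k) x)) -` {v} = (T ^^ k) -` (X -` {v})" for v by auto
  then have fib: "prob ((\<lambda>x. X ((T ^^ k) x)) -` {v}) = prob (X -` {v})" for v
    using prob_vimage_iterate[OF vimage_simple[OF X]] by simp
  have "range (\<lambda>x. X ((T ^^ k) x)) \<subseteq> range X" by auto
  then show ?thesis
    by (simp add: entropy_eq[OF simple_function_iterate[OF X] finite_range_simple[OF X]]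
        entropy_eq[OF X finite_range_simple[OF X]] fib)
qed

lemma simple_function_itinerary:
  assumes X: "simple_function M X"
  shows "simple_function M (itinerary T X n)"
proof (induction n)
  case (Suc n)
  have "simple_function M (\<lambda>x. itinerary T X n x @ [X ((T ^^ n) x)])"
    by (rule simple_function_compose2[OF Suc simple_function_iterate[OF X]])
  then show ?case by (simp add: itinerary_Suc[abs_def])
qed (simp add: itinerary_def[abs_def])

text \<open>The long itinerary is determined by that of \<open>x\<close> and that of
  \<open>(T ^^ m) x\<close>, and by invariance the latter has the entropy of an itinerary of length
  \<open>n\<close>. This is the input for Fekete's lemma.\<close>

lemma entropy_itinerary_add_le:
  assumes X: "simple_function M X"
  shows "\<H>(itinerary T X (m + n)) \<le> \<H>(itinerary T X m) + \<H>(itinerary T X n)"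
proof -
  note sf = simple_function_itinerary[OF X]
  have "\<H>(itinerary T X (m + n)) \<le> \<H>(\<lambda>x. (itinerary T X m x, itinerary T X n ((T ^^ m) x)))"
    by (intro entropy_determined simple_function_Pair sf simple_function_iterate[OF sf])
      (simp add: itinerary_add)
  also have "\<dots> \<le> \<H>(itinerary T X m) + \<H>(\<lambda>x. itinerary T X n ((T ^^ m) x))"
    by (intro entropy_Pair_le sf simple_function_iterate[OF sf])
  finally show ?thesis by (simp add: entropy_iterate[OF sf])
qed

lemma entropy_itinerary_le:
  fixes X :: "'a \<Rightarrow> 'b"
  assumes X: "simple_function M X"
  shows "\<H>(itinerary T X n) \<le> real n * \<H>(X)"
proof (induction n)
  case 0
  have "itinerary T X 0 = (\<lambda>x. [])" by (simp add: itinerary_def[abs_def])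
  then show ?case
    using entropy_eq[of "\<lambda>x. [] :: 'b list" "{[]}"] prob_space by (simp add: space_M)
next
  case (Suc n)
  have "\<H>(itinerary T X 1) \<le> \<H>(X)"
    by (intro entropy_determined X) (simp add: itinerary_def)
  then show ?case using entropy_itinerary_add_le[OF X, of n 1] Suc by (simp add: algebra_simps)
qed

lemma simple_function_cell:
  assumes "borel_partition \<xi>"
  shows "simple_function M (cell \<xi>)"
proof -
  have \<xi>: "partition_on UNIV \<xi>" "finite \<xi>" "\<xi> \<subseteq> sets borel" using assms by (auto simp: borel_partition_def)
  have "finite (range (cell \<xi>))"
    by (rule finite_subset[OF _ \<xi>(2)]) (auto intro: cell(1)[OF \<xi>(1)])
  moreover have "cell \<xi> -` {cell \<xi> x} \<in> sets M" for x
    using cell_vimage[OF \<xi>(1) cell(1)[OF \<xi>(1)]] cell(1)[OF \<xi>(1)] \<xi>(3) by (auto simp: sets_M)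
  ultimately show ?thesis by (auto simp: simple_function_def space_M)
qed

lemma partition_entropy_iterated_join:
  assumes \<xi>: "borel_partition \<xi>"
  shows "partition_entropy M (iterated_join T \<xi> n) = \<H>(itinerary T (cell \<xi>) n)"
proof -
  let ?I = "itinerary T (cell \<xi>) n"
  have sf: "simple_function M ?I" by (intro simple_function_itinerary simple_function_cell \<xi>)
  have inj: "inj_on (\<lambda>v. ?I -` {v}) (range ?I)" by (rule inj_onI) blast
  have "partition_on UNIV \<xi>" using \<xi> by (simp add: borel_partition_def)
  then show ?thesis
    unfolding partition_entropy_def entropy_eq[OF sf finite_range_simple[OF sf] order_refl]
    by (simp add: iterated_join_eq sum.reindex[OF inj])
qed

text \<open>Maximal cardinality: a point not within \<delta> of any member of \<open>E\<close> could
  be added. So \<open>E\<close> is separated, for comparison with \<open>separated_sup\<close>, and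
  also spanning, for the choice of nearby points.\<close>

lemma maximal_separated_set:
  assumes "n > 0" "\<delta> > 0"
  obtains E where "finite E" "E \<noteq> {}" "separated T n \<delta> E"
    "\<And>x. \<exists>y\<in>E. \<forall>k<n. dist ((T ^^ k) x) ((T ^^ k) y) \<le> \<delta>"
proof -
  obtain N where N: "\<And>E. finite E \<Longrightarrow> separated T n \<delta> E \<Longrightarrow> card E \<le> N"
    by (rule separated_card_le[OF assms], rule that)
  have "\<exists>E. (finite E \<and> separated T n \<delta> E) \<and> (\<forall>E'. finite E' \<and> separated T n \<delta> E' \<longrightarrow> card E' \<le> card E)"
    by (rule Lattices_Big.ex_has_greatest_nat[where k="{}" and b="Suc N"])
      (use N in \<open>auto simp: separated_def less_Suc_eq_le\<close>)
  then obtain E where E: "finite E" "separated T n \<delta> E"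
    "\<And>E'. finite E' \<Longrightarrow> separated T n \<delta> E' \<Longrightarrow> card E' \<le> card E" by blast
  have span: "\<exists>y\<in>E. \<forall>k<n. dist ((T ^^ k) x) ((T ^^ k) y) \<le> \<delta>" for x
  proof (rule ccontr)
    assume "\<not> ?thesis"
    then have far: "\<And>y. y \<in> E \<Longrightarrow> \<exists>k<n. \<delta> < dist ((T ^^ k) x) ((T ^^ k) y)" by (auto simp: not_le)
    then have "x \<notin> E" using assms by fastforce
    moreover have "separated T n \<delta> (insert x E)"
      using far E(2) unfolding separated_iff[OF assms(1)] by (auto simp: dist_commute)
    ultimately show False using E(3)[of "insert x E"] E(1) by simp
  qed
  moreover then have "E \<noteq> {}" by blast
  ultimately show ?thesis using E that by blast
qed

text \<open>Replacing \<open>f\<close> by its composition with \<pi> costs at most \<open>c\<close>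
  and turns the integral into a finite sum, to which the Gibbs inequality applies with the fibre
  probabilities as weights.\<close>

lemma entropy_plus_energy_le:
  fixes f :: "'a \<Rightarrow> real"
  assumes E: "finite E" "E \<noteq> {}" and \<pi>: "simple_function M \<pi>" "range \<pi> \<subseteq> E"
    and f: "continuous_on UNIV f" and close: "\<And>x. f x \<le> f (\<pi> x) + c"
  shows "\<H>(\<pi>) + (\<integral>x. f x \<partial>M) \<le> ln (\<Sum>y\<in>E. exp (f y)) + c"
proof -
  have mem: "\<pi> x \<in> E" for x using \<pi>(2) by auto
  have eq: "f (\<pi> x) = (\<Sum>y\<in>E. f y * indicator (\<pi> -` {y}) x)" for x
  proof -
    have "(\<Sum>y\<in>E. f y * indicator (\<pi> -` {y}) x) = (\<Sum>y\<in>E. if y = \<pi> x then f y else 0)"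
      by (intro sum.cong) (auto simp: indicator_def)
    then show ?thesis using mem E by simp
  qed
  have meas: "\<pi> -` {y} \<in> sets M" for y using vimage_simple[OF \<pi>(1)] by (simp add: sets_M)
  have int: "integrable M (\<lambda>x. f y * indicator (\<pi> -` {y}) x)" for y
    using meas by (intro integrable_mult_right integrable_real_indicator) (auto simp: less_top[symmetric])
  have "(\<integral>x. f (\<pi> x) \<partial>M) = (\<Sum>y\<in>E. \<integral>x. f y * indicator (\<pi> -` {y}) x \<partial>M)"
    unfolding eq by (intro Bochner_Integration.integral_sum int)
  also have "\<dots> = (\<Sum>y\<in>E. prob (\<pi> -` {y}) * f y)"
    using meas by (intro sum.cong) (simp_all add: space_M mult.commute)
  finally have I: "(\<integral>x. f (\<pi> x) \<partial>M) = (\<Sum>y\<in>E. prob (\<pi> -` {y}) * f y)" .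
  have int\<pi>: "integrable M (\<lambda>x. f (\<pi> x))"
    unfolding eq by (intro Bochner_Integration.integrable_sum int)
  have "(\<integral>x. f x \<partial>M) \<le> (\<integral>x. f (\<pi> x) + c \<partial>M)"
    using close by (intro integral_mono integrable_invariant[OF invariant f]) (auto intro: int\<pi>)
  also have "\<dots> = (\<integral>x. f (\<pi> x) \<partial>M) + c" using int\<pi> by (simp add: prob_space)
  finally have "(\<integral>x. f x \<partial>M) \<le> (\<Sum>y\<in>E. prob (\<pi> -` {y}) * f y) + c" by (simp add: I)
  moreover have "\<H>(\<pi>) + (\<Sum>y\<in>E. prob (\<pi> -` {y}) * f y) \<le> ln (\<Sum>y\<in>E. exp (f y))"
    unfolding entropy_eq[OF \<pi>(1) E(1) \<pi>(2)]
    by (intro gibbs_inequality E sum_prob_fibres[OF \<pi>(1) E(1) \<pi>(2)]) simp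
  ultimately show ?thesis by linarith
qed

text \<open>Regularity gives closed cores inside the members of \<xi>, compact because the space is.
  Disjoint compact sets have positive distance, and only finitely many pairs occur.\<close>

lemma exists_separated_cores:
  assumes \<xi>: "borel_partition \<xi>" and s: "s > 0"
  obtains B d where "\<And>A. A \<in> \<xi> \<Longrightarrow> B A \<subseteq> A \<and> B A \<in> sets borel \<and> prob (A - B A) < s" "d > 0"
    "\<And>A A' x y. A \<in> \<xi> \<Longrightarrow> A' \<in> \<xi> \<Longrightarrow> A \<noteq> A' \<Longrightarrow> x \<in> B A \<Longrightarrow> y \<in> B A' \<Longrightarrow> d \<le> dist x y"
proof -
  have \<xi>': "finite \<xi>" "\<xi> \<subseteq> sets borel" "disjoint \<xi>"
    using \<xi> by (auto simp: borel_partition_def partition_on_def)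
  have "\<exists>F. closed F \<and> F \<subseteq> A \<and> prob (A - F) < s" if "A \<in> \<xi>" for A
  proof -
    have A: "A \<in> sets borel" using \<xi>' that by blast
    obtain F U where FU: "closed F" "open U" "F \<subseteq> A" "A \<subseteq> U" "prob (U - F) < s"
      using closed_open_approx[OF finite_measure_axioms sets_M A s] by blast
    have "prob (A - F) \<le> prob (U - F)" using FU by (intro finite_measure_mono) (auto simp: sets_M)
    then show ?thesis using FU by (intro exI[of _ F]) auto
  qed
  then obtain B where B: "\<And>A. A \<in> \<xi> \<Longrightarrow> closed (B A)" "\<And>A. A \<in> \<xi> \<Longrightarrow> B A \<subseteq> A"
    "\<And>A. A \<in> \<xi> \<Longrightarrow> prob (A - B A) < s" by metis
  have "\<exists>d>0. \<forall>x\<in>B A. \<forall>y\<in>B A'. d \<le> dist x y" if "A \<in> \<xi>" "A' \<in> \<xi>" "A \<noteq> A'" for A A'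
  proof (rule compact_closed_separated)
    show "compact (B A)" using compact_Int_closed[OF compact_space B(1)[OF that(1)]] by simp
    have "A \<inter> A' = {}" using \<xi>'(3) that by (auto simp: disjoint_def)
    then show "B A \<inter> B A' = {}" using B(2) that by blast
  qed (use B that in auto)
  then obtain d where d: "\<And>A A'. A \<in> \<xi> \<Longrightarrow> A' \<in> \<xi> \<Longrightarrow> A \<noteq> A' \<Longrightarrow> d A A' > 0 \<and> (\<forall>x\<in>B A. \<forall>y\<in>B A'. d A A' \<le> dist x y)"
    by metis
  \<comment> \<open>The element 1 keeps \<open>D\<close> nonempty if \<xi> has a single
    member.\<close>
  define D where "D = insert 1 ((\<lambda>(A, A'). d A A') ` {(A, A'). A \<in> \<xi> \<and> A' \<in> \<xi> \<and> A \<noteq> A'})"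
  have "finite {(A, A'). A \<in> \<xi> \<and> A' \<in> \<xi> \<and> A \<noteq> A'}"
    by (rule finite_subset[of _ "\<xi> \<times> \<xi>"]) (use \<xi>' in auto)
  then have D: "finite D" "D \<noteq> {}" by (auto simp: D_def)
  show ?thesis
  proof
    show "B A \<subseteq> A \<and> B A \<in> sets borel \<and> prob (A - B A) < s" if "A \<in> \<xi>" for A
      using B that by auto
    show "Min D > 0" using D d by (auto simp: D_def)
    fix A A' x y assume *: "A \<in> \<xi>" "A' \<in> \<xi>" "A \<noteq> A'" "x \<in> B A" "y \<in> B A'"
    then have "d A A' \<in> D" by (force simp: D_def)
    then have "Min D \<le> d A A'" using D by simp
    also have "\<dots> \<le> dist x y" using d * by blast
    finally show "Min D \<le> dist x y" .
  qed
qed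

text \<open>The value \<open>{}\<close> marks points inside a core. It cannot be confused with a
  cell, since partitions have no empty members.\<close>

definition core_complement :: "'a set set \<Rightarrow> ('a set \<Rightarrow> 'a set) \<Rightarrow> 'a \<Rightarrow> 'a set" where
  "core_complement \<xi> B x = (if x \<in> B (cell \<xi> x) then {} else cell \<xi> x)"

text \<open>The value \<open>{}\<close> has probability at least \<open>1 - card \<xi> * s\<close>
  and every other one at most \<open>s\<close>; the two estimates for single entropy terms handle
  these cases.\<close>

lemma entropy_core_complement:
  assumes \<xi>: "borel_partition \<xi>" and s: "s > 0" "2 * sqrt s \<le> r"
    and B: "\<And>A. A \<in> \<xi> \<Longrightarrow> B A \<subseteq> A \<and> B A \<in> sets borel \<and> prob (A - B A) < s"
  shows "simple_function M (core_complement \<xi> B)"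
    "\<H>(core_complement \<xi> B) \<le> real (card \<xi>) * (r + s)"
proof -
  have part: "partition_on UNIV \<xi>" and fin: "finite \<xi>" and \<xi>b: "\<xi> \<subseteq> sets borel"
    using \<xi> by (auto simp: borel_partition_def)
  have ne: "{} \<notin> \<xi>" using part by (simp add: partition_on_def)
  let ?\<rho> = "core_complement \<xi> B"
  have range: "range ?\<rho> \<subseteq> insert {} \<xi>"
    using cell(1)[OF part] by (auto simp: core_complement_def)
  have fibre: "?\<rho> -` {A} = A - B A" if "A \<in> \<xi>" for A
  proof -
    have "core_complement \<xi> B x = A \<longleftrightarrow> x \<in> A - B A" for x
      unfolding core_complement_def using cell(3)[OF part that, of x] that ne by auto
    then show ?thesis by blast
  qed
  have fibre0: "?\<rho> -` {{}} = (\<Union>A\<in>\<xi>. B A)"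
  proof -
    have "core_complement \<xi> B x = {} \<longleftrightarrow> (\<exists>A\<in>\<xi>. x \<in> B A)" for x
    proof
      assume "core_complement \<xi> B x = {}"
      then show "\<exists>A\<in>\<xi>. x \<in> B A"
        using cell(1)[OF part, of x] ne by (auto simp: core_complement_def split: if_splits)
    next
      assume "\<exists>A\<in>\<xi>. x \<in> B A"
      then obtain A where "A \<in> \<xi>" "x \<in> B A" by blast
      moreover from this have "cell \<xi> x = A" using cell(3)[OF part, of A x] B[of A] by blast
      ultimately show "core_complement \<xi> B x = {}" by (simp add: core_complement_def)
    qed
    then show ?thesis by blast
  qed
  have "?\<rho> -` {v} \<in> sets M" if "v \<in> insert {} \<xi>" for v
    using that fibre fibre0 fin B \<xi>b by (auto simp: sets_M intro!: sets.finite_UN sets.Diff)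
  then have "\<forall>v\<in>range ?\<rho>. ?\<rho> -` {v} \<in> sets M" using range by blast
  then show sf: "simple_function M ?\<rho>"
    using finite_subset[OF range] fin by (simp add: simple_function_def space_M)
  define t where "t A = prob (A - B A)" for A
  have t: "0 \<le> t A" "A \<in> \<xi> \<Longrightarrow> t A \<le> s" for A using B by (auto simp: t_def less_imp_le)
  have sum1: "prob (?\<rho> -` {{}}) + (\<Sum>A\<in>\<xi>. t A) = 1"
    using sum_prob_fibres[OF sf _ range] fin ne fibre by (simp add: t_def)
  have "\<H>(?\<rho>) = - (prob (?\<rho> -` {{}}) * ln (prob (?\<rho> -` {{}}))) + (\<Sum>A\<in>\<xi>. - (t A * ln (t A)))"
    using entropy_eq[OF sf _ range] fin ne fibre by (simp add: t_def sum_negf)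
  also have "\<dots> \<le> (1 - prob (?\<rho> -` {{}})) + (\<Sum>A\<in>\<xi>. r)"
  proof (intro add_mono sum_mono)
    fix A assume "A \<in> \<xi>"
    then have "sqrt (t A) \<le> sqrt s" using t by simp
    then show "- (t A * ln (t A)) \<le> r" using entropy_term_le_sqrt[OF t(1), of A] s(2) by linarith
  qed (simp add: entropy_term_le_compl)
  also have "1 - prob (?\<rho> -` {{}}) \<le> (\<Sum>A\<in>\<xi>. s)"
    using sum1 sum_mono[of \<xi> t "\<lambda>_. s"] t by simp
  finally show "\<H>(?\<rho>) \<le> real (card \<xi>) * (r + s)" by (simp add: algebra_simps)
qed

text \<open>Half of \<open>e\<close> pays for the entropy of the itinerary of
  \<open>core_complement\<close>, half for the variation of \<psi> at distance \<delta>. What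
  remains, the entropy of \<pi> plus the energy, is bounded through the separated set.\<close>

lemma entropy_plus_integral_le_pressure_partition:
  assumes \<psi>: "continuous_on UNIV \<psi>" and \<xi>: "borel_partition \<xi>"
  shows "ereal (lim (\<lambda>n. partition_entropy M (iterated_join T \<xi> n) / real n)) + ereal (\<integral>x. \<psi> x \<partial>M)
    \<le> pressure T \<psi>"
proof (rule ereal_le_epsilon2)
  fix e :: real assume e: "e > 0"
  have part: "partition_on UNIV \<xi>" using \<xi> by (simp add: borel_partition_def)
  \<comment> \<open>The constants give
    \<open>card \<xi> * (r + s) \<le> c * (2 * r) = e / 2\<close>; the summand 1 keeps the divisor
    positive, and \<open>s\<close> is small enough for \<open>2 * sqrt s \<le> r\<close>.\<close>
  define c where "c = real (card \<xi>) + 1"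
  define r where "r = e / (4 * c)"
  have c: "c > 0" by (simp add: c_def)
  then have r: "r > 0" using e by (simp add: r_def)
  define s where "s = min r ((r / 2)\<^sup>2)"
  have s: "s > 0" "s \<le> r" using r by (simp_all add: s_def)
  have "sqrt s \<le> sqrt ((r / 2)\<^sup>2)" by (rule real_sqrt_le_mono) (simp add: s_def)
  also have "\<dots> = r / 2" using r by simp
  finally have s2: "2 * sqrt s \<le> r" by simp
  obtain B d where B: "\<And>A. A \<in> \<xi> \<Longrightarrow> B A \<subseteq> A \<and> B A \<in> sets borel \<and> prob (A - B A) < s" and d: "d > 0"
    "\<And>A A' x y. A \<in> \<xi> \<Longrightarrow> A' \<in> \<xi> \<Longrightarrow> A \<noteq> A' \<Longrightarrow> x \<in> B A \<Longrightarrow> y \<in> B A' \<Longrightarrow> d \<le> dist x y"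
    by (rule exists_separated_cores[OF \<xi> s(1)]) (rule that; assumption)
  let ?\<rho> = "core_complement \<xi> B" and ?\<alpha> = "cell \<xi>"
  have sf\<rho>: "simple_function M ?\<rho>" and "\<H>(?\<rho>) \<le> real (card \<xi>) * (r + s)"
    using entropy_core_complement[OF \<xi> s(1) s2 B] by auto
  moreover have "real (card \<xi>) * (r + s) \<le> c * (2 * r)"
    using s r by (intro mult_mono) (auto simp: c_def)
  moreover have "c * (2 * r) = e / 2" using c by (simp add: r_def field_simps)
  ultimately have H\<rho>: "\<H>(?\<rho>) \<le> e / 2" by simp
  have "uniformly_continuous_on UNIV \<psi>" using compact_uniformly_continuous[OF \<psi> compact_space] .
  then obtain d' where d': "d' > 0" "\<And>x y. dist x y < d' \<Longrightarrow> dist (\<psi> x) (\<psi> y) < e / 2"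
    unfolding uniformly_continuous_on_def using e by (metis UNIV_I half_gt_zero)
  \<comment> \<open>Orbits of points with the same image under \<pi> stay within
    \<open>2 * \<delta> < d\<close> of each other before time \<open>n\<close>, too close for two
    different cores; \<open>\<delta> < d'\<close> controls \<psi>.\<close>
  define \<delta> where "\<delta> = min d d' / 3"
  have \<delta>: "\<delta> > 0" "2 * \<delta> < d" "\<delta> < d'" using d d' by (auto simp: \<delta>_def min_def)
  note sf\<alpha> = simple_function_cell[OF \<xi>]
  define a where "a n = \<H>(itinerary T ?\<alpha> n)" for n
  have bound: "a n / real n + ((\<integral>x. \<psi> x \<partial>M) - e) \<le> ln (separated_sup T \<psi> n \<delta>) / real n" if n: "n > 0" for n
  proof -
    obtain E where E: "finite E" "E \<noteq> {}" "separated T n \<delta> E"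
      "\<And>x. \<exists>y\<in>E. \<forall>k<n. dist ((T ^^ k) x) ((T ^^ k) y) \<le> \<delta>"
      by (rule maximal_separated_set[OF n \<delta>(1)]) (rule that; assumption)
    define W where "W y = {x. \<forall>k<n. dist ((T ^^ k) x) ((T ^^ k) y) \<le> \<delta>}" for y
    have W: "W y \<in> sets M" for y
    proof -
      have "W y = (\<Inter>k<n. {x. dist ((T ^^ k) x) ((T ^^ k) y) \<le> \<delta>})" by (auto simp: W_def)
      moreover have "closed {x. dist ((T ^^ k) x) ((T ^^ k) y) \<le> \<delta>}" for k
        by (intro closed_Collect_le continuous_intros continuous_iterate)
      ultimately have "closed (W y)" by auto
      then show ?thesis by (simp add: sets_M)
    qed
    obtain \<pi> where \<pi>: "simple_function M \<pi>" "\<And>x. \<pi> x \<in> E \<and> x \<in> W (\<pi> x)"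
      using finite_measurable_selection[OF E(1), of W M] W E(4) by (auto simp: W_def space_M)
    have close: "dist ((T ^^ k) x) ((T ^^ k) (\<pi> x)) \<le> \<delta>" if "k < n" for k x
      using \<pi>(2)[of x] that by (auto simp: W_def)
    have "a n \<le> \<H>(\<lambda>x. (\<pi> x, itinerary T ?\<rho> n x))"
      unfolding a_def
    proof (rule entropy_determined)
      show "simple_function M (\<lambda>x. (\<pi> x, itinerary T ?\<rho> n x))"
        by (intro simple_function_Pair \<pi>(1) simple_function_itinerary sf\<rho>)
      fix x y assume xy: "(\<pi> x, itinerary T ?\<rho> n x) = (\<pi> y, itinerary T ?\<rho> n y)"
      \<comment> \<open>If the cells differ while the values of \<open>core_complement\<close>
        agree, the common value must be \<open>{}\<close>; the two points then lie in different
        cores, at distance at least \<open>d\<close>.\<close>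
      have "?\<alpha> ((T ^^ k) x) = ?\<alpha> ((T ^^ k) y)" if k: "k < n" for k
      proof (rule ccontr)
        let ?x = "(T ^^ k) x" and ?y = "(T ^^ k) y"
        assume ne: "?\<alpha> ?x \<noteq> ?\<alpha> ?y"
        have eq: "?\<rho> ?x = ?\<rho> ?y" using xy k by (simp add: itinerary_eq_iff)
        have "?\<alpha> ?x \<noteq> {}" "?\<alpha> ?y \<noteq> {}" using cell(2)[OF part] by blast+
        then have "?x \<in> B (?\<alpha> ?x)" "?y \<in> B (?\<alpha> ?y)"
          using eq ne by (auto simp: core_complement_def split: if_splits)
        then have "d \<le> dist ?x ?y" using d(2) ne cell(1)[OF part] by blast
        moreover have "dist ?x ?y \<le> dist ?x ((T ^^ k) (\<pi> x)) + dist ?y ((T ^^ k) (\<pi> x))"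
          by (rule dist_triangle2)
        ultimately show False using close[OF k, of x] close[OF k, of y] xy \<delta>(2) by simp
      qed
      then show "itinerary T ?\<alpha> n x = itinerary T ?\<alpha> n y" by (simp add: itinerary_eq_iff)
    qed
    also have "\<dots> \<le> \<H>(\<pi>) + \<H>(itinerary T ?\<rho> n)"
      by (intro entropy_Pair_le \<pi>(1) simple_function_itinerary sf\<rho>)
    also have "\<H>(itinerary T ?\<rho> n) \<le> real n * (e / 2)"
      using entropy_itinerary_le[OF sf\<rho>, of n] H\<rho> mult_left_mono[OF H\<rho>, of "real n"] by linarith
    finally have a_le: "a n \<le> \<H>(\<pi>) + real n * (e / 2)" by simp
    have "\<H>(\<pi>) + (\<integral>x. birkhoff_sum T \<psi> n x \<partial>M) \<le> ln (\<Sum>y\<in>E. exp (birkhoff_sum T \<psi> n y)) + real n * (e / 2)"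
    proof (rule entropy_plus_energy_le[OF E(1,2) \<pi>(1)])
      fix x
      have "\<psi> ((T ^^ k) x) \<le> \<psi> ((T ^^ k) (\<pi> x)) + e / 2" if "k < n" for k
      proof -
        have "dist (\<psi> ((T ^^ k) x)) (\<psi> ((T ^^ k) (\<pi> x))) < e / 2"
          using close[OF that, of x] \<delta>(3) by (intro d'(2)) simp
        then show ?thesis unfolding dist_real_def by linarith
      qed
      then have "birkhoff_sum T \<psi> n x \<le> (\<Sum>k<n. \<psi> ((T ^^ k) (\<pi> x)) + e / 2)"
        unfolding birkhoff_sum_def by (intro sum_mono) auto
      then show "birkhoff_sum T \<psi> n x \<le> birkhoff_sum T \<psi> n (\<pi> x) + real n * (e / 2)"
        by (simp add: birkhoff_sum_def sum.distrib)
    qed (use \<pi>(2) continuous_birkhoff_sum[OF \<psi>] in auto)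
    also have "ln (\<Sum>y\<in>E. exp (birkhoff_sum T \<psi> n y)) \<le> ln (separated_sup T \<psi> n \<delta>)"
      using E separated_sup_upper[OF n \<delta>(1) \<psi> E(1,3)] by (intro ln_mono) (auto intro!: sum_pos)
    finally have "a n + real n * ((\<integral>x. \<psi> x \<partial>M) - e) \<le> ln (separated_sup T \<psi> n \<delta>)"
      using a_le by (simp add: integral_birkhoff_sum[OF invariant \<psi>] algebra_simps)
    from divide_right_mono[OF this, of "real n"] show ?thesis using n by (simp add: add_divide_distrib)
  qed
  define L where "L = lim (\<lambda>n. a n / real n)"
  have "convergent (\<lambda>n. a n / real n)"
    unfolding a_def by (intro subadditive_quotient_convergent entropy_itinerary_add_le[OF sf\<alpha>]
        entropy_nonneg simple_function_itinerary[OF sf\<alpha>])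
  then have "(\<lambda>n. a n / real n) \<longlonglongrightarrow> L" by (simp add: convergent_LIMSEQ_iff L_def)
  then have "(\<lambda>n. ereal (a n / real n + ((\<integral>x. \<psi> x \<partial>M) - e))) \<longlonglongrightarrow> ereal (L + ((\<integral>x. \<psi> x \<partial>M) - e))"
    by (intro tendsto_intros)
  then have "ereal (L + ((\<integral>x. \<psi> x \<partial>M) - e)) = limsup (\<lambda>n. ereal (a n / real n + ((\<integral>x. \<psi> x \<partial>M) - e)))"
    by (intro lim_imp_Limsup[symmetric]) auto
  also have "\<dots> \<le> pressure_at T \<psi> \<delta>"
    unfolding pressure_at_def by (intro Limsup_mono eventually_sequentiallyI[of 1]) (simp add: bound)
  also have "\<dots> \<le> pressure T \<psi>" by (rule pressure_at_le_pressure[OF \<psi> \<delta>(1)])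
  finally have "ereal (L + ((\<integral>x. \<psi> x \<partial>M) - e)) + ereal e \<le> pressure T \<psi> + ereal e" by (rule add_right_mono)
  then show "ereal (lim (\<lambda>n. partition_entropy M (iterated_join T \<xi> n) / real n)) + ereal (\<integral>x. \<psi> x \<partial>M)
      \<le> pressure T \<psi> + ereal e"
    by (simp add: L_def a_def partition_entropy_iterated_join[OF \<xi>])
qed

section \<open>The entropy inequality and equilibrium states\<close>

lemma measure_entropy_plus_integral_le_pressure:
  assumes \<psi>: "continuous_on UNIV \<psi>"
  shows "measure_entropy T M + ereal (\<integral>x. \<psi> x \<partial>M) \<le> pressure T \<psi>"
proof -
  have "measure_entropy T M \<le> pressure T \<psi> - ereal (\<integral>x. \<psi> x \<partial>M)"
    unfolding measure_entropy_def
    using entropy_plus_integral_le_pressure_partition[OF \<psi>] by (intro SUP_least) (simp add: ereal_le_minus)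
  then show ?thesis by (simp add: ereal_le_minus)
qed

end

text \<open>The pressure of \<psi> is at least the entropy plus the integral of \<psi>, and at an
  equilibrium state this is the pressure of \<phi> plus the integral of
  \<open>\<psi> - \<phi>\<close>. The Radon condition is regularity, as closed sets are compact
  here.\<close>

lemma (in compact_system) measure_mem_pressure_subdifferential:
  assumes \<mu>: "equilibrium_state T \<phi> \<mu>"
    and \<phi>: "continuous_on UNIV \<phi>" "\<bar>pressure T \<phi>\<bar> \<noteq> \<infinity>"
  shows "measure \<mu> \<in> pressure_subdifferential T \<phi>"
proof -
  have inv: "\<mu> \<in> invariant_measures T" using \<mu> by (simp add: equilibrium_state_def)
  interpret invariant_system T \<mu> by unfold_locales (rule inv)
  have sub: "pressure T \<phi> + ereal (signed_integral (measure \<mu>) (\<lambda>x. \<psi> x - \<phi> x)) \<le> pressure T \<psi>"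
    if \<psi>: "continuous_on UNIV \<psi>" for \<psi>
  proof -
    have "signed_integral (measure \<mu>) (\<lambda>x. \<psi> x - \<phi> x) = (\<integral>x. \<psi> x \<partial>\<mu>) - (\<integral>x. \<phi> x \<partial>\<mu>)"
      unfolding signed_integral_measure[OF finite_measure_axioms sets_M]
      by (intro Bochner_Integration.integral_diff integrable_invariant[OF inv] \<phi> \<psi>)
    moreover have "measure_entropy T \<mu> + ereal (\<integral>x. \<phi> x \<partial>\<mu>) = pressure T \<phi>"
      using \<mu> by (simp add: equilibrium_state_def)
    moreover note measure_entropy_plus_integral_le_pressure[OF \<psi>]
    ultimately show ?thesis using \<phi>(2)
      by (cases "measure_entropy T \<mu>"; cases "pressure T \<phi>"; cases "pressure T \<psi>") auto
  qed
  have inner: "\<exists>K. compact K \<and> K \<in> sets borel \<and> K \<subseteq> A \<and> (\<forall>B\<in>sets borel. B \<subseteq> A - K \<longrightarrow> \<bar>prob B\<bar> < e)"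
    if A: "A \<in> sets borel" and e: "e > 0" for A e
  proof -
    obtain F U where FU: "closed F" "open U" "F \<subseteq> A" "A \<subseteq> U" "prob (U - F) < e"
      using closed_open_approx[OF finite_measure_axioms sets_M A e] by blast
    have "prob B < e" if "B \<in> sets borel" "B \<subseteq> A - F" for B
    proof -
      have "prob B \<le> prob (U - F)" using that FU by (intro finite_measure_mono) (auto simp: sets_M)
      then show ?thesis using FU by simp
    qed
    moreover have "compact F" using compact_Int_closed[OF compact_space FU(1)] by simp
    ultimately show ?thesis using FU by (intro exI[of _ F]) auto
  qed
  have "measure \<mu> \<in> signed_radon_measures"
    unfolding signed_radon_measures_def
    using inner finite_measure_UNION by (auto simp: sets_M measure_notin_sets)
  then show ?thesis using sub by (simp add: pressure_subdifferential_def)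
qed

theorem proposition4p6:
  fixes T :: "'a::metric_space \<Rightarrow> 'a" and \<phi> :: "'a \<Rightarrow> real" and \<mu> :: "'a measure"
  assumes compact_space: "compact (UNIV :: 'a set)"
    and continuous_T: "continuous_on UNIV T"
    and continuous_\<phi>: "continuous_on UNIV \<phi>"
    and real_valued_pressure: "\<And>\<psi> :: 'a \<Rightarrow> real. continuous_on UNIV \<psi> \<Longrightarrow> \<bar>pressure T \<psi>\<bar> \<noteq> \<infinity>"
    and equilibrium: "equilibrium_state T \<phi> \<mu>"
    and ergodic: "ergodic T \<mu>"
  shows "exposed_point (pressure_subdifferential T \<phi>) (measure \<mu>)"
proof -
  interpret compact_system T by unfold_locales (fact compact_space continuous_T)+
  note real = real_valued_pressure[OF continuous_\<phi>]
  have \<mu>: "\<mu> \<in> invariant_measures T" using ergodic by (simp add: ergodic_def)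
  obtain \<psi> :: "'a \<Rightarrow> real" where \<psi>: "continuous_on UNIV \<psi>"
    "\<And>\<nu>. \<nu> \<in> invariant_measures T \<Longrightarrow> \<nu> \<noteq> \<mu> \<Longrightarrow> (\<integral>x. \<psi> x \<partial>\<nu>) < (\<integral>x. \<psi> x \<partial>\<mu>)"
    by (rule ergodic_exposed[OF ergodic]) (rule that; assumption)
  \<comment> \<open>Every subgradient is an invariant probability measure, so the function exposing
    \<mu> among these also exposes it in the subdifferential.\<close>
  have "signed_integral \<nu> \<psi> < signed_integral (measure \<mu>) \<psi>"
    if \<nu>: "\<nu> \<in> pressure_subdifferential T \<phi> - {measure \<mu>}" for \<nu>
  proof -
    obtain M where M: "M \<in> invariant_measures T" "\<nu> = measure M"
      using subgradient_is_invariant_measure[OF _ continuous_\<phi> real] \<nu> by blast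
    then have "M \<noteq> \<mu>" using \<nu> by blast
    from \<psi>(2)[OF M(1) this] show ?thesis
      using invariant_measureD(2,3)[OF M(1)] invariant_measureD(2,3)[OF \<mu>] M(2)
      by (simp add: signed_integral_measure)
  qed
  then show ?thesis
    using measure_mem_pressure_subdifferential[OF equilibrium continuous_\<phi> real] \<psi>(1)
    unfolding exposed_point_def by blast
qed

end
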